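(* Let $F$ be a full vertex algebra. For $a,b\in F$ the following hold: 1. $Y(Da,\underline z)=\frac{d}{dz}Y(a,\underline z)$ and $Y(\bar Da,\underline z)=\frac{d}{d\bar z}Y(a,\underline z)$; 2. $D\mathbf 1=\bar D\mathbf 1=0$; 3. $[D,\bar D]=0$; 4. $Y(a,\underline z)b=\exp(zD+\bar z\bar D)Y(b,-\underline z)a$; 5. $Y(\bar Da,\underline z)=[\bar D,Y(a,\underline z)]$ and $Y(Da,\underline z)=[D,Y(a,\underline z)]$.
   Context: **Conventions.** $z,\bar z$ are independent formal variables, $\underline z=(z,\bar z)$, and $|z|$ stands for $z\bar z$ in exponents, so $|z|^r=z^r\bar z^r$. For a vector space $V$, $V[[z,\bar z,|z|^{\mathbb R}]]$ is the set of formal sums $\sum_{r,s\in\mathbb R}a_{r,s}z^r\bar z^s$ with countable support and $a_{r,s}=0$ unless $r-s\in\mathbb Z$; $V((z,\bar z,|z|^{\mathbb R}))$ is the subspace of those for which there is $N$ with $a_{r,s}=0$ unless $r,s\ge N$. $\frac d{dz}$, $\frac d{d\bar z}$ are the termwise formal derivatives. **Function spaces.** $F_{0,1,\infty}$ is the space of real analytic functions $f:\mathbb CP^1\setminus\{0,1,\infty\}\to\mathbb C$ with conformal singularities at $0,1,\infty$: for each $\alpha\in\{0,1,\infty\}$ and each holomorphic chart $\chi$ at $\alpha$ with $\chi(\alpha)=0$ there is a series in $\mathbb C((p,\bar p,|p|^{\mathbb R}))$ converging absolutely and compactly to $f\circ\chi^{-1}(p)$ in some punctured disc around $p=0$. For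 $\chi\in\{p,1/p,1-1/p\}$ ($p$ the standard coordinate) this uniquely determined series is denoted $j(\chi,f)$. $\mathrm{GCor}_2$ is the complex span of the functions on $Y_2=\{(z_1,z_2)\in\mathbb C^2: z_1\ne z_2, z_1\ne0,z_2\neq 0\}$ $$\mu=z_1^{\alpha_1}z_2^{\alpha_2}(z_1-z_2)^{\alpha_{12}}\bar z_1^{\beta_1}\bar z_2^{\beta_2}(\bar z_1-\bar z_2)^{\beta_{12}}f(z_2/z_1),$$ $f\in F_{0,1,\infty}$, $\alpha$'s, $\beta$'s real with $\alpha_1-\beta_1,\alpha_2-\beta_2,\alpha_{12}-\beta_{12}\in\mathbb Z$. Its expansions, extended linearly, are: $\mu|_{|z_1|>|z_2|}$: expand $(z_1-z_2)^{\alpha_{12}}(\bar z_1-\bar z_2)^{\beta_{12}}$ binomially in non-negative powers of $z_2/z_1,\bar z_2/\bar z_1$ and replace $f(z_2/z_1)$ by $j(p,f)$ at $p=z_2/z_1$; $\mu|_{|z_2|>|z_1|}$: expand in non-negative powers of $z_1/z_2,\bar z_1/\bar z_2$ (with sign $(-1)^{\alpha_{12}-\beta_{12}}$) and replace $f(z_2/z_1)$ by $j(p^{-1},f)$ at $p=z_1/z_2$; $\mu|_{|z_2|>|z_1-z_2|}$: put $z_1=z_2+z_0$, expand $(z_2+z_0)^{\alpha_1}(\bar z_2+\bar z_0)^{\beta_1}$ in non-negative powers of $z_0/z_2,\bar z_0/\bar z_2$ and replace $f(z_2/z_1)$ by $j(1-p^{-1},f)$ at $p=-z_0/z_2$. **Full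 vertex algebra.** For $F=\bigoplus_{h,\bar h\in\mathbb R}F_{h,\bar h}$ put $F^\vee=\bigoplus F_{h,\bar h}^*$. A full vertex algebra is such an $F$ over $\mathbb C$ with $Y(-,\underline z):F\to\mathrm{End}(F)[[z,\bar z,|z|^{\mathbb R}]]$, $Y(a,\underline z)=\sum_{r,s\in\mathbb R}a(r,s)z^{-r-1}\bar z^{-s-1}$, and $\mathbf 1\in F_{0,0}$ such that: (FV1) for all $a,b$ there is $N$ with $a(r,s)b=0$ if $r\ge N$ or $s\ge N$; (FV2) $F_{h,\bar h}=0$ unless $h-\bar h\in\mathbb Z$; (FV3) $Y(a,\underline z)\mathbf 1\in F[[z,\bar z]]$ with constant term $a$; (FV4) $Y(\mathbf 1,\underline z)=\mathrm{id}$; (FV5) for all $a,b,c\in F$, $u\in F^\vee$ there is $\mu\in\mathrm{GCor}_2$ with $u(Y(a,\underline z_1)Y(b,\underline z_2)c)=\mu|_{|z_1|>|z_2|}$, $u(Y(Y(a,\underline z_0)b,\underline z_2)c)=\mu|_{|z_2|>|z_1-z_2|}$ ($z_0=z_1-z_2$), $u(Y(b,\underline z_2)Y(a,\underline z_1)c)=\mu|_{|z_2|>|z_1|}$; (FV6) $F_{h,\bar h}(r,s)F_{h',\bar h'}\subset F_{h+h'-r-1,\bar h+\bar h'-s-1}$. $D,\bar D\in\mathrm{End}F$ are defined by $Y(a,\underline z)\mathbf 1=a+Da\,z+\bar Da\,\bar z+\cdots$. $Y(b,-\underline z)$ is obtained from $Y(b,\underline z)$ by replacing each $z^r\bar z^s$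 by $(-1)^{r-s}z^r\bar z^s$ (well defined since only $r-s\in\mathbb Z$ occurs). *)

theory Defs
  imports "HOL-Analysis.Analysis" "HOL-Library.Function_Algebras"
begin

section \<open>Formal series with real exponents\<close>

text \<open>
  A formal sum of \<open>a\<^sub>r\<^sub>s z\<^sup>r zbar\<^sup>s\<close> is represented by its coefficient function \<open>\<lambda>r s. a\<^sub>r\<^sub>s\<close>.
  The first index always is the exponent of the variable, the second one that of its conjugate.
\<close>

definition formal_series :: "(real \<Rightarrow> real \<Rightarrow> 'v::zero) set" where
  "formal_series = {A. countable {(r, s). A r s \<noteq> 0} \<and> (\<forall>r s. A r s \<noteq> 0 \<longrightarrow> r - s \<in> \<int>)}"

definition formal_series_bdd :: "(real \<Rightarrow> real \<Rightarrow> 'v::zero) set" where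
  "formal_series_bdd = {A \<in> formal_series. \<exists>N. \<forall>r s. A r s \<noteq> 0 \<longrightarrow> r \<ge> N \<and> s \<ge> N}"

definition formal_dz ::
  "(complex \<Rightarrow> 'v \<Rightarrow> 'v) \<Rightarrow> (real \<Rightarrow> real \<Rightarrow> 'v) \<Rightarrow> real \<Rightarrow> real \<Rightarrow> 'v" where
  "formal_dz smul A = (\<lambda>r s. smul (of_real (r + 1)) (A (r + 1) s))"

definition formal_dzbar ::
  "(complex \<Rightarrow> 'v \<Rightarrow> 'v) \<Rightarrow> (real \<Rightarrow> real \<Rightarrow> 'v) \<Rightarrow> real \<Rightarrow> real \<Rightarrow> 'v" where
  "formal_dzbar smul A = (\<lambda>r s. smul (of_real (s + 1)) (A r (s + 1)))"

text \<open>Replacing the variable \<open>z\<close> by \<open>-z\<close>; only meaningful on exponents with \<open>r - s\<close> an integer.\<close>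

definition formal_neg :: "(real \<Rightarrow> real \<Rightarrow> 'v::uminus) \<Rightarrow> real \<Rightarrow> real \<Rightarrow> 'v" where
  "formal_neg A = (\<lambda>r s. if even \<lfloor>r - s\<rfloor> then A r s else - A r s)"

text \<open>
  The product of a series bounded from below with \<open>(1 - p)\<^sup>\<alpha> (1 - pbar)\<^sup>\<beta>\<close>, expanded in
  non-negative powers of \<open>p\<close> and \<open>pbar\<close>. The index set of the sum is then finite.
\<close>

definition binomial_mult ::
  "real \<Rightarrow> real \<Rightarrow> (real \<Rightarrow> real \<Rightarrow> complex) \<Rightarrow> real \<Rightarrow> real \<Rightarrow> complex" where
  "binomial_mult \<alpha> \<beta> A = (\<lambda>r s.
     \<Sum>(i, j) \<in> {(i::nat, j::nat). A (r - real i) (s - real j) \<noteq> 0}.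
       of_real ((\<alpha> gchoose i) * (-1) ^ i) * of_real ((\<beta> gchoose j) * (-1) ^ j)
         * A (r - real i) (s - real j))"


section \<open>Real analytic functions with conformal singularities\<close>

text \<open>
  The function \<open>z\<^sup>r zbar\<^sup>s\<close> for \<open>r - s\<close> an integer, i.e. \<open>z\<^sup>r\<^sup>-\<^sup>s (z zbar)\<^sup>s\<close>; single-valued on
  the punctured plane.
\<close>

definition zpow :: "real \<Rightarrow> real \<Rightarrow> complex \<Rightarrow> complex" where
  "zpow r s z = z powi \<lfloor>r - s\<rfloor> * of_real (((cmod z)\<^sup>2) powr s)"

definition real_analytic_on :: "(complex \<Rightarrow> complex) \<Rightarrow> complex set \<Rightarrow> bool" where
  "real_analytic_on f U \<longleftrightarrow>
     (\<forall>z\<in>U. \<exists>(c :: nat \<Rightarrow> nat \<Rightarrow> complex) \<rho>. \<rho> > 0 \<and>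
        (\<forall>w. cmod w < \<rho> \<longrightarrow>
           ((\<lambda>(m, n). c m n * of_real (Re w) ^ m * of_real (Im w) ^ n) has_sum f (z + w)) UNIV))"

definition expands_at_0 ::
  "(complex \<Rightarrow> complex) \<Rightarrow> (real \<Rightarrow> real \<Rightarrow> complex) \<Rightarrow> bool" where
  "expands_at_0 g A \<longleftrightarrow> A \<in> formal_series_bdd \<and>
     (\<exists>R>0.
        (\<forall>p \<in> ball 0 R - {0}. (\<lambda>(r, s). norm (A r s * zpow r s p)) summable_on UNIV) \<and>
        (\<forall>K. compact K \<and> K \<subseteq> ball 0 R - {0} \<longrightarrow>
           uniform_limit K (\<lambda>S p. \<Sum>(r, s)\<in>S. A r s * zpow r s p) g
             (finite_subsets_at_top UNIV)))"

definition holomorphic_chart :: "complex \<Rightarrow> (complex \<Rightarrow> complex) \<Rightarrow> complex set \<Rightarrow> bool" where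
  "holomorphic_chart \<alpha> \<phi> U \<longleftrightarrow>
     open U \<and> \<alpha> \<in> U \<and> \<phi> holomorphic_on U \<and> inj_on \<phi> U \<and> \<phi> \<alpha> = 0"

definition conformal_singularity :: "(complex \<Rightarrow> complex) \<Rightarrow> complex \<Rightarrow> bool" where
  "conformal_singularity f \<alpha> \<longleftrightarrow>
     (\<forall>\<phi> U. holomorphic_chart \<alpha> \<phi> U \<longrightarrow> (\<exists>A. expands_at_0 (\<lambda>p. f (inv_into U \<phi> p)) A))"

text \<open>
  The Riemann sphere without \<open>0, 1, \<infinity>\<close> is the plane without \<open>0, 1\<close>; values of \<open>f\<close> at
  \<open>0\<close> and \<open>1\<close> are irrelevant. The charts at \<open>\<infinity>\<close> are the functions \<open>p \<mapsto> \<phi> (1/p)\<close> with \<open>\<phi>\<close> a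
  chart at \<open>0\<close>, so a singularity at \<open>\<infinity>\<close> is one of \<open>f (1/p)\<close> at \<open>0\<close>.
\<close>

definition F01inf :: "(complex \<Rightarrow> complex) set" where
  "F01inf = {f. real_analytic_on f (- {0, 1}) \<and>
     conformal_singularity f 0 \<and> conformal_singularity f 1 \<and>
     conformal_singularity (\<lambda>w. f (1 / w)) 0}"

text \<open>
  The expansions of \<open>f\<close> in the charts \<open>p\<close>, \<open>1/p\<close> and \<open>1 - 1/p\<close>, whose inverses are
  \<open>p\<close>, \<open>1/p\<close> and \<open>1/(1 - p)\<close>.
\<close>

definition j_zero :: "(complex \<Rightarrow> complex) \<Rightarrow> real \<Rightarrow> real \<Rightarrow> complex" where
  "j_zero f = (THE A. expands_at_0 f A)"

definition j_inf :: "(complex \<Rightarrow> complex) \<Rightarrow> real \<Rightarrow> real \<Rightarrow> complex" where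
  "j_inf f = (THE A. expands_at_0 (\<lambda>p. f (1 / p)) A)"

definition j_one :: "(complex \<Rightarrow> complex) \<Rightarrow> real \<Rightarrow> real \<Rightarrow> complex" where
  "j_one f = (THE A. expands_at_0 (\<lambda>p. f (1 / (1 - p))) A)"


section \<open>Generalized two-point correlation functions\<close>

definition Y2 :: "(complex \<times> complex) set" where
  "Y2 = {(z\<^sub>1, z\<^sub>2). z\<^sub>1 \<noteq> z\<^sub>2 \<and> z\<^sub>1 \<noteq> 0 \<and> z\<^sub>2 \<noteq> 0}"

record gcor_data =
  \<alpha>\<^sub>1 :: real  \<alpha>\<^sub>2 :: real  \<alpha>\<^sub>1\<^sub>2 :: real
  \<beta>\<^sub>1 :: real  \<beta>\<^sub>2 :: real  \<beta>\<^sub>1\<^sub>2 :: real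
  cross :: "complex \<Rightarrow> complex"

definition gcor_data_ok :: "gcor_data \<Rightarrow> bool" where
  "gcor_data_ok d \<longleftrightarrow>
     \<alpha>\<^sub>1 d - \<beta>\<^sub>1 d \<in> \<int> \<and> \<alpha>\<^sub>2 d - \<beta>\<^sub>2 d \<in> \<int> \<and> \<alpha>\<^sub>1\<^sub>2 d - \<beta>\<^sub>1\<^sub>2 d \<in> \<int> \<and> cross d \<in> F01inf"

text \<open>Functions on \<open>Y2\<close> are extended by zero.\<close>

definition gcor_fun :: "gcor_data \<Rightarrow> complex \<times> complex \<Rightarrow> complex" where
  "gcor_fun d = (\<lambda>(z\<^sub>1, z\<^sub>2). if (z\<^sub>1, z\<^sub>2) \<in> Y2 then
     zpow (\<alpha>\<^sub>1 d) (\<beta>\<^sub>1 d) z\<^sub>1 * zpow (\<alpha>\<^sub>2 d) (\<beta>\<^sub>2 d) z\<^sub>2 * zpow (\<alpha>\<^sub>1\<^sub>2 d) (\<beta>\<^sub>1\<^sub>2 d) (z\<^sub>1 - z\<^sub>2)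
       * cross d (z\<^sub>2 / z\<^sub>1)
     else 0)"

definition GCor2 :: "(complex \<times> complex \<Rightarrow> complex) set" where
  "GCor2 = module.span (\<lambda>c \<mu> z. c * \<mu> z) (gcor_fun ` {d. gcor_data_ok d})"

text \<open>
  Formal series in two variables and their conjugates; \<open>E r s r' s'\<close> is the coefficient of
  \<open>x\<^sup>r xbar\<^sup>s y\<^sup>r\<^sup>' ybar\<^sup>s\<^sup>'\<close>. The series \<open>ratio_series a b a' b' S\<close> is
  \<open>x\<^sup>a xbar\<^sup>b y\<^sup>a\<^sup>' ybar\<^sup>b\<^sup>' S(x/y)\<close>.
\<close>

type_synonym formal_series2 = "real \<Rightarrow> real \<Rightarrow> real \<Rightarrow> real \<Rightarrow> complex"

definition ratio_series ::
  "real \<Rightarrow> real \<Rightarrow> real \<Rightarrow> real \<Rightarrow> (real \<Rightarrow> real \<Rightarrow> complex) \<Rightarrow> formal_series2" where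
  "ratio_series a b a' b' S = (\<lambda>r s r' s'.
     if r + r' = a + a' \<and> s + s' = b + b' then S (r - a) (s - b) else 0)"

text \<open>
  Region \<open>|z\<^sub>1| > |z\<^sub>2|\<close>, indexed by the exponents of \<open>z\<^sub>1\<close>, then \<open>z\<^sub>2\<close>:
  \<open>(z\<^sub>1 - z\<^sub>2)\<^sup>\<alpha> = z\<^sub>1\<^sup>\<alpha> (1 - p)\<^sup>\<alpha>\<close> with \<open>p = z\<^sub>2/z\<^sub>1\<close>.
\<close>

definition gcor_exp_12 :: "gcor_data \<Rightarrow> formal_series2" where
  "gcor_exp_12 d = (\<lambda>r\<^sub>1 s\<^sub>1 r\<^sub>2 s\<^sub>2.
     ratio_series (\<alpha>\<^sub>2 d) (\<beta>\<^sub>2 d) (\<alpha>\<^sub>1 d + \<alpha>\<^sub>1\<^sub>2 d) (\<beta>\<^sub>1 d + \<beta>\<^sub>1\<^sub>2 d)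
       (binomial_mult (\<alpha>\<^sub>1\<^sub>2 d) (\<beta>\<^sub>1\<^sub>2 d) (j_zero (cross d))) r\<^sub>2 s\<^sub>2 r\<^sub>1 s\<^sub>1)"

text \<open>
  Region \<open>|z\<^sub>2| > |z\<^sub>1|\<close>, indexed by the exponents of \<open>z\<^sub>1\<close>, then \<open>z\<^sub>2\<close>:
  \<open>(z\<^sub>1 - z\<^sub>2)\<^sup>\<alpha> = (-1)\<^sup>\<alpha> z\<^sub>2\<^sup>\<alpha> (1 - p)\<^sup>\<alpha>\<close> with \<open>p = z\<^sub>1/z\<^sub>2\<close>.
\<close>

definition gcor_exp_21 :: "gcor_data \<Rightarrow> formal_series2" where
  "gcor_exp_21 d = (\<lambda>r\<^sub>1 s\<^sub>1 r\<^sub>2 s\<^sub>2.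
     (-1) powi \<lfloor>\<alpha>\<^sub>1\<^sub>2 d - \<beta>\<^sub>1\<^sub>2 d\<rfloor> *
     ratio_series (\<alpha>\<^sub>1 d) (\<beta>\<^sub>1 d) (\<alpha>\<^sub>2 d + \<alpha>\<^sub>1\<^sub>2 d) (\<beta>\<^sub>2 d + \<beta>\<^sub>1\<^sub>2 d)
       (binomial_mult (\<alpha>\<^sub>1\<^sub>2 d) (\<beta>\<^sub>1\<^sub>2 d) (j_inf (cross d))) r\<^sub>1 s\<^sub>1 r\<^sub>2 s\<^sub>2)"

text \<open>
  Region \<open>|z\<^sub>2| > |z\<^sub>1 - z\<^sub>2|\<close>, indexed by the exponents of \<open>z\<^sub>0 = z\<^sub>1 - z\<^sub>2\<close>, then \<open>z\<^sub>2\<close>: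
  \<open>z\<^sub>1\<^sup>\<alpha> = z\<^sub>2\<^sup>\<alpha> (1 - p)\<^sup>\<alpha>\<close> with \<open>p = -z\<^sub>0/z\<^sub>2\<close>.
\<close>

definition gcor_exp_02 :: "gcor_data \<Rightarrow> formal_series2" where
  "gcor_exp_02 d =
     ratio_series (\<alpha>\<^sub>1\<^sub>2 d) (\<beta>\<^sub>1\<^sub>2 d) (\<alpha>\<^sub>1 d + \<alpha>\<^sub>2 d) (\<beta>\<^sub>1 d + \<beta>\<^sub>2 d)
       (formal_neg (binomial_mult (\<alpha>\<^sub>1 d) (\<beta>\<^sub>1 d) (j_one (cross d))))"

text \<open>
  The linear extension of an expansion rule \<open>X\<close> on generators, as a graph: the pairs
  \<open>(\<mu>, E)\<close> in the complex span of the pairs \<open>(gcor_fun d, X d)\<close>.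
\<close>

definition gcor_expands ::
  "(gcor_data \<Rightarrow> formal_series2) \<Rightarrow> (complex \<times> complex \<Rightarrow> complex) \<Rightarrow> formal_series2 \<Rightarrow> bool" where
  "gcor_expands X \<mu> E \<longleftrightarrow>
     (\<mu>, E) \<in> module.span (\<lambda>c (\<mu>, E). (\<lambda>z. c * \<mu> z, \<lambda>r s r' s'. c * E r s r' s'))
                ((\<lambda>d. (gcor_fun d, X d)) ` {d. gcor_data_ok d})"

lemma module_GCor2: "module (\<lambda>(c::complex) (\<mu> :: complex \<times> complex \<Rightarrow> complex) z. c * \<mu> z)"
  by unfold_locales (auto simp: fun_eq_iff algebra_simps)

lemma module_gcor_graph:
  "module (\<lambda>(c::complex) (\<mu> :: complex \<times> complex \<Rightarrow> complex, E :: formal_series2).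
     (\<lambda>z. c * \<mu> z, \<lambda>r s r' s'. c * E r s r' s'))"
  by unfold_locales (auto simp: fun_eq_iff algebra_simps)


section \<open>Full vertex algebras\<close>

text \<open>The direct sum of the duals, as functionals vanishing on almost all graded pieces.\<close>

definition restricted_dual ::
  "(complex \<Rightarrow> 'v \<Rightarrow> 'v) \<Rightarrow> (real \<Rightarrow> real \<Rightarrow> 'v set) \<Rightarrow> ('v::ab_group_add \<Rightarrow> complex) set" where
  "restricted_dual smul F = {u. Vector_Spaces.linear smul (*) u \<and>
     finite {(h, h'). \<exists>v \<in> F h h'. u v \<noteq> 0}}"

text \<open>
  \<open>Y a r s\<close> is the coefficient of \<open>z\<^sup>r zbar\<^sup>s\<close> in \<open>Y(a, z)\<close>, while \<open>mode Y a r s\<close> is the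
  mode \<open>a(r, s)\<close>, the coefficient of \<open>z\<^sup>-\<^sup>r\<^sup>-\<^sup>1 zbar\<^sup>-\<^sup>s\<^sup>-\<^sup>1\<close>.
\<close>

definition mode :: "('v \<Rightarrow> real \<Rightarrow> real \<Rightarrow> 'v \<Rightarrow> 'v) \<Rightarrow> 'v \<Rightarrow> real \<Rightarrow> real \<Rightarrow> 'v \<Rightarrow> 'v" where
  "mode Y a r s = Y a (- r - 1) (- s - 1)"

locale full_vertex_algebra = vector_space smul
  for smul :: "complex \<Rightarrow> 'v::ab_group_add \<Rightarrow> 'v" +
  fixes F :: "real \<Rightarrow> real \<Rightarrow> 'v set"
    and Y :: "'v \<Rightarrow> real \<Rightarrow> real \<Rightarrow> 'v \<Rightarrow> 'v"
    and vac :: 'v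
  assumes grading_subspace: "subspace (F h h')"
    and grading_direct_sum:
      "\<exists>!w :: real \<times> real \<Rightarrow> 'v. finite {k. w k \<noteq> 0} \<and> (\<forall>h h'. w (h, h') \<in> F h h') \<and>
         v = (\<Sum>k | w k \<noteq> 0. w k)"
    and Y_linear: "Vector_Spaces.linear smul smul (\<lambda>a. Y a r s b)"
    and Y_endo: "Vector_Spaces.linear smul smul (Y a r s)"
    and Y_formal_series: "Y a \<in> formal_series"
    and vac_grading: "vac \<in> F 0 0"
    and FV1: "\<exists>N. \<forall>r s. r \<ge> N \<or> s \<ge> N \<longrightarrow> mode Y a r s b = 0"
    and FV2: "h - h' \<notin> \<int> \<Longrightarrow> F h h' = {0}"
    and FV3_power_series: "Y a r s vac \<noteq> 0 \<Longrightarrow> r \<in> \<nat> \<and> s \<in> \<nat>"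
    and FV3_constant_term: "Y a 0 0 vac = a"
    and FV4: "Y vac = (\<lambda>r s. if r = 0 \<and> s = 0 then id else 0)"
    and FV5: "u \<in> restricted_dual smul F \<Longrightarrow>
      \<exists>\<mu> \<in> GCor2.
        gcor_expands gcor_exp_12 \<mu> (\<lambda>r\<^sub>1 s\<^sub>1 r\<^sub>2 s\<^sub>2. u (Y a r\<^sub>1 s\<^sub>1 (Y b r\<^sub>2 s\<^sub>2 c))) \<and>
        gcor_expands gcor_exp_02 \<mu> (\<lambda>r\<^sub>0 s\<^sub>0 r\<^sub>2 s\<^sub>2. u (Y (Y a r\<^sub>0 s\<^sub>0 b) r\<^sub>2 s\<^sub>2 c)) \<and>
        gcor_expands gcor_exp_21 \<mu> (\<lambda>r\<^sub>1 s\<^sub>1 r\<^sub>2 s\<^sub>2. u (Y b r\<^sub>2 s\<^sub>2 (Y a r\<^sub>1 s\<^sub>1 c)))"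
    and FV6: "a \<in> F h\<^sub>1 h\<^sub>1' \<Longrightarrow> b \<in> F h\<^sub>2 h\<^sub>2' \<Longrightarrow>
      mode Y a r s b \<in> F (h\<^sub>1 + h\<^sub>2 - r - 1) (h\<^sub>1' + h\<^sub>2' - s - 1)"

definition translation :: "('v \<Rightarrow> real \<Rightarrow> real \<Rightarrow> 'v \<Rightarrow> 'v) \<Rightarrow> 'v \<Rightarrow> 'v \<Rightarrow> 'v" where
  "translation Y vac a = Y a 1 0 vac"

definition translation_bar :: "('v \<Rightarrow> real \<Rightarrow> real \<Rightarrow> 'v \<Rightarrow> 'v) \<Rightarrow> 'v \<Rightarrow> 'v \<Rightarrow> 'v" where
  "translation_bar Y vac a = Y a 0 1 vac"

definition commutator :: "('v \<Rightarrow> 'v) \<Rightarrow> ('v \<Rightarrow> 'v) \<Rightarrow> 'v \<Rightarrow> 'v::ab_group_add" where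
  "commutator S T = (\<lambda>v. S (T v) - T (S v))"

text \<open>The coefficient of \<open>z\<^sup>i zbar\<^sup>j\<close> in \<open>(z S + zbar T)\<^sup>n\<close>; \<open>S\<close> and \<open>T\<close> need not commute.\<close>

fun zSzT_power :: "('v \<Rightarrow> 'v) \<Rightarrow> ('v \<Rightarrow> 'v) \<Rightarrow> nat \<Rightarrow> nat \<Rightarrow> nat \<Rightarrow> 'v \<Rightarrow> 'v::ab_group_add" where
  "zSzT_power S T 0 i j v = (if i = 0 \<and> j = 0 then v else 0)"
| "zSzT_power S T (Suc n) i j v =
     (if i > 0 then S (zSzT_power S T n (i - 1) j v) else 0) +
     (if j > 0 then T (zSzT_power S T n i (j - 1) v) else 0)"

text \<open>
  The coefficient of \<open>z\<^sup>i zbar\<^sup>j\<close> in \<open>exp (z S + zbar T)\<close>, to which only the power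
  \<open>n = i + j\<close> contributes.
\<close>

definition exp_zSzT ::
  "(complex \<Rightarrow> 'v \<Rightarrow> 'v) \<Rightarrow> ('v \<Rightarrow> 'v) \<Rightarrow> ('v \<Rightarrow> 'v) \<Rightarrow> nat \<Rightarrow> nat \<Rightarrow> 'v \<Rightarrow> 'v::ab_group_add" where
  "exp_zSzT smul S T i j v = smul (1 / fact (i + j)) (zSzT_power S T (i + j) i j v)"

text \<open>
  The product of an operator-valued power series with a vector-valued formal series, for
  series whose exponents are bounded from below: then the index set of the sum is finite.
\<close>

definition power_series_apply ::
  "(nat \<Rightarrow> nat \<Rightarrow> 'v \<Rightarrow> 'v) \<Rightarrow> (real \<Rightarrow> real \<Rightarrow> 'v) \<Rightarrow> real \<Rightarrow> real \<Rightarrow> 'v::ab_group_add" where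
  "power_series_apply P A = (\<lambda>r s.
     \<Sum>(i, j) \<in> {(i::nat, j::nat). A (r - real i) (s - real j) \<noteq> 0}.
       P i j (A (r - real i) (s - real j)))"

end

theory Submission
  imports Defs "HOL-Complex_Analysis.Conformal_Mappings"
begin

text \<open>
  Let \<open>u\<close> be a functional concentrated in one degree and \<open>a, b, c\<close> homogeneous. Then each of the
  three matrix elements in the locality axiom is supported on a single total exponent, and two of the
  three expansions of \<open>\<mu>\<close> suffice: the one in \<open>\<bar>z\<^sub>2\<bar> > \<bar>z\<^sub>1\<bar>\<close> and the one in
  \<open>\<bar>z\<^sub>2\<bar> > \<bar>z\<^sub>1 - z\<^sub>2\<bar>\<close>.

  Take \<open>b = vac\<close>. The first of these is a single monomial \<open>C z\<^sub>1\<^sup>H zbar\<^sub>1\<^sup>H\<^sup>'\<close>, so \<open>\<mu>\<close>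
  is this monomial in an open region and hence everywhere. Its expansion in \<open>z\<^sub>0 = z\<^sub>1 - z\<^sub>2\<close> is the
  binomial series of \<open>(z\<^sub>2 + z\<^sub>0)\<^sup>H (zbar\<^sub>2 + zbar\<^sub>0)\<^sup>H\<^sup>'\<close>, and comparing coefficients gives
  \<open>Y(a\<^sub>i\<^sub>j vac, z)\<close> as the divided derivative of \<open>Y(a, z)\<close> of order \<open>(i, j)\<close>, where \<open>a\<^sub>i\<^sub>j vac\<close> is
  the coefficient of \<open>z\<^sup>i zbar\<^sup>j\<close> in \<open>Y(a, z) vac\<close> (\<open>Y_mode_vac\<close>). The orders \<open>(1, 0)\<close> and \<open>(0, 1)\<close>
  are the derivative formulas; they imply that \<open>D\<close> and \<open>D'\<close> commute and that
  \<open>Y(v, z) vac = exp (z D + zbar D') v\<close>.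

  Take \<open>c = vac\<close>. Since \<open>Y(a, z\<^sub>0) b\<close> is bounded from below in \<open>z\<^sub>0\<close> and \<open>Y(v, z\<^sub>2) vac\<close> has only
  non-negative powers, the expansion in \<open>\<bar>z\<^sub>2\<bar> > \<bar>z\<^sub>1 - z\<^sub>2\<bar>\<close> is a finite sum; it therefore
  represents \<open>\<mu>\<close> everywhere. As \<open>z\<^sub>1\<close> tends to \<open>0\<close> the expansion in \<open>\<bar>z\<^sub>2\<bar> > \<bar>z\<^sub>1\<bar>\<close> has the leading
  term \<open>u (Y(b, z\<^sub>2) a)\<close>, while the finite sum becomes \<open>u (exp (z\<^sub>2 D + zbar\<^sub>2 D') Y(a, - z\<^sub>2) b)\<close>. This is
  skew-symmetry (\<open>skew_symmetry\<close>). Differentiating skew-symmetry yields the commutator formulas.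

  Two analytic facts carry the argument. A series with real exponents bounded from below is
  determined by its sum near \<open>0\<close> (\<open>formal_series_bdd_eqI\<close>); this also makes the expansions
  of functions with conformal singularities well defined. A function in \<open>GCor2\<close> that agrees near
  \<open>z\<^sub>1/z\<^sub>2 = 0\<close> or \<open>z\<^sub>1/z\<^sub>2 = 1\<close> with an explicit real analytic one agrees with it
  everywhere (\<open>GCor2_eqI\<close>), by an identity theorem for real analytic functions of \<open>z\<^sub>2/z\<^sub>1\<close> on the plane without
  \<open>0\<close> and \<open>1\<close> (\<open>axis_analytic_identity\<close>).
\<close>

section \<open>The functions \<open>z\<^sup>r zbar\<^sup>s\<close>\<close>

lemma zpow_add:
  assumes "z \<noteq> 0" "r - s \<in> \<int>" "r' - s' \<in> \<int>"
  shows "zpow (r + r') (s + s') z = zpow r s z * zpow r' s' z"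
proof -
  obtain m n where *: "r - s = of_int m" "r' - s' = of_int n"
    using assms(2,3) by (auto elim!: Ints_cases)
  then have "(r + r') - (s + s') = of_int (m + n)" by simp
  then have "\<lfloor>(r + r') - (s + s')\<rfloor> = m + n" "\<lfloor>r - s\<rfloor> = m" "\<lfloor>r' - s'\<rfloor> = n"
    using * by (metis floor_of_int)+
  then show ?thesis
    using assms(1) by (simp add: zpow_def power_int_add powr_add)
qed

lemma zpow_mult: "zpow r s (z * w) = zpow r s z * zpow r s w"
  by (simp add: zpow_def power_int_mult_distrib norm_mult power_mult_distrib powr_mult)

lemma zpow_minus: "zpow r s (- z) = (if even \<lfloor>r - s\<rfloor> then zpow r s z else - zpow r s z)"
  by (simp add: zpow_def power_int_minus_left)

lemma zpow_0_0 [simp]: "z \<noteq> 0 \<Longrightarrow> zpow 0 0 z = 1"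
  by (simp add: zpow_def)

lemma zpow_one [simp]: "zpow r s 1 = 1"
  by (simp add: zpow_def)

lemma zpow_divide:
  assumes "w \<noteq> 0" "r - s \<in> \<int>"
  shows "zpow r s (z / w) = zpow r s z * zpow (- r) (- s) w"
proof -
  have "zpow r s z = zpow r s (z / w) * zpow r s w"
    using assms by (simp flip: zpow_mult)
  moreover have "zpow r s w * zpow (- r) (- s) w = 1"
    using assms zpow_add[of w r s "- r" "- s"] Ints_minus[OF assms(2)] by simp
  ultimately show ?thesis by (simp add: mult.assoc)
qed

lemma zpow_of_nat:
  assumes "z \<noteq> 0"
  shows "zpow (real i) (real j) z = z ^ i * cnj z ^ j"
proof -
  have "real i - real j = of_int (int i - int j)" by simp
  then have "\<lfloor>real i - real j\<rfloor> = int i - int j" by (metis floor_of_int)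
  moreover have "((cmod z)\<^sup>2) powr real j = ((cmod z)\<^sup>2) ^ j"
    using assms by (simp add: powr_realpow)
  moreover have "complex_of_real (((cmod z)\<^sup>2) ^ j) = (z * cnj z) ^ j"
    using complex_norm_square[of z] by (simp only: of_real_power)
  ultimately show ?thesis
    using assms by (simp add: zpow_def power_int_diff power_mult_distrib flip: of_real_power)
qed

lemma zpow_cis:
  assumes "r - s \<in> \<int>"
  shows "zpow r s (cis \<theta>) = cis ((r - s) * \<theta>)"
proof -
  obtain n where "r - s = of_int n" using assms by (auto elim!: Ints_cases)
  then show ?thesis by (simp add: zpow_def cis_power_int)
qed

lemma zpow_exp:
  assumes "r - s \<in> \<int>"
  shows "zpow r s (of_real (exp x)) = of_real (exp ((r + s) * x))"
proof -
  obtain n where n: "r - s = of_int n" using assms by (auto elim!: Ints_cases)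
  have 1: "complex_of_real (exp x) powi n = of_real (exp (of_int n * x))"
    by (simp add: exp_power_int flip: of_real_power_int)
  have 2: "((exp x)\<^sup>2) powr s = exp (2 * s * x)"
    by (simp add: powr_def flip: exp_double)
  have "of_int n * x + 2 * s * x = (r + s) * x"
    by (simp add: algebra_simps flip: n)
  then show ?thesis
    using n by (simp add: zpow_def 1 2 flip: of_real_mult exp_add)
qed

lemma has_sum_times:
  fixes f :: "'a \<Rightarrow> complex" and g :: "'b \<Rightarrow> complex"
  assumes f: "(f has_sum a) A" and g: "(g has_sum b) B"
  shows "((\<lambda>(x, y). f x * g y) has_sum a * b) (A \<times> B)"
proof (rule has_sum_SigmaI)
  show "((\<lambda>y. case (x, y) of (x, y) \<Rightarrow> f x * g y) has_sum f x * b) B" for x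
    using has_sum_cmult_right[OF g] by simp
  show "((\<lambda>x. f x * b) has_sum a * b) A"
    by (rule has_sum_cmult_left[OF f])
  have f': "(\<lambda>x. norm (f x)) summable_on A" and g': "(\<lambda>x. norm (g x)) summable_on B"
    using f g has_sum_imp_summable summable_on_iff_abs_summable_on_complex by blast+
  have "(\<lambda>z. norm (case z of (x, y) \<Rightarrow> f x * g y)) summable_on A \<times> B"
  proof (rule summable_on_SigmaI)
    show "((\<lambda>y. norm (case (x, y) of (x, y) \<Rightarrow> f x * g y)) has_sum
            norm (f x) * infsum (\<lambda>y. norm (g y)) B) B" for x
      using has_sum_cmult_right[OF has_sum_infsum[OF g']] by (simp add: norm_mult)
    show "(\<lambda>x. norm (f x) * infsum (\<lambda>y. norm (g y)) B) summable_on A"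
      by (rule summable_on_cmult_left[OF f'])
  qed simp
  then show "(\<lambda>(x, y). f x * g y) summable_on A \<times> B"
    by (rule abs_summable_summable)
qed

text \<open>
  The series of \<open>(1 - p)\<^sup>\<alpha> (1 - pbar)\<^sup>\<beta>\<close>: the product of two principal branches, which is
  single-valued because \<open>\<alpha> - \<beta>\<close> is an integer.
\<close>

lemma zpow_binomial:
  assumes "norm p < 1" "\<alpha> - \<beta> \<in> \<int>"
  shows "((\<lambda>(i, j). of_real ((\<alpha> gchoose i) * (-1) ^ i) * of_real ((\<beta> gchoose j) * (-1) ^ j)
            * (p ^ i * cnj p ^ j)) has_sum zpow \<alpha> \<beta> (1 - p)) UNIV"
proof -
  have hs: "((\<lambda>i. of_real ((a gchoose i) * (-1) ^ i) * x ^ i) has_sum (1 - x) powr (of_real a)) UNIV"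
    if "norm x < 1" for a :: real and x :: complex
  proof -
    have gc: "of_real (a gchoose i) = (complex_of_real a gchoose i)" for i
      by (simp add: gbinomial_prod_rev)
    have sums: "(\<lambda>i. of_real ((a gchoose i) * (-1) ^ i) * x ^ i) sums (1 - x) powr (of_real a)"
      using gen_binomial_complex[of "- x" "of_real a"] that
      by (simp add: gc power_minus[of x] mult.assoc)
    have "summable (\<lambda>i. norm (of_real ((a gchoose i) * (-1) ^ i) * x ^ i))"
    proof -
      obtain y :: real where y: "norm x < y" "y < 1" using \<open>norm x < 1\<close> dense by blast
      have "summable (\<lambda>i. (complex_of_real a gchoose i) * (- of_real y) ^ i)"
        using gen_binomial_complex[of "- of_real y" "of_real a"] y
          norm_ge_zero[of x] by (auto simp: sums_iff simp del: norm_ge_zero)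
      from powser_insidea[OF this, of "- x"] show ?thesis
        using y norm_ge_zero[of x]
        by (simp add: gc norm_mult norm_power power_minus[of x] mult.assoc del: norm_ge_zero)
    qed
    with sums show ?thesis
      by (intro norm_summable_imp_has_sum) (auto simp: sums_iff)
  qed
  have "((\<lambda>(i, j). (of_real ((\<alpha> gchoose i) * (-1) ^ i) * p ^ i) *
            (of_real ((\<beta> gchoose j) * (-1) ^ j) * cnj p ^ j))
          has_sum (1 - p) powr (of_real \<alpha>) * (1 - cnj p) powr (of_real \<beta>)) (UNIV \<times> UNIV)"
    using assms(1) by (intro has_sum_times hs) auto
  moreover have "(1 - p) powr (of_real \<alpha>) * (1 - cnj p) powr (of_real \<beta>) = zpow \<alpha> \<beta> (1 - p)"
  proof -
    define w where "w = 1 - p"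
    have "Re w > 0"
      using assms(1) complex_Re_le_cmod[of p] by (simp add: w_def)
    then have w: "w \<noteq> 0" "w \<notin> \<real>\<^sub>\<le>\<^sub>0"
      by (auto simp: complex_nonpos_Reals_iff)
    obtain n where n: "\<alpha> - \<beta> = of_int n" using assms(2) by (auto elim!: Ints_cases)
    have "w powr (of_real \<alpha>) * cnj w powr (of_real \<beta>)
        = w powr (of_real (\<alpha> - \<beta>)) * (w powr (of_real \<beta>) * cnj w powr (of_real \<beta>))"
      by (simp flip: mult.assoc powr_add)
    also have "w powr (of_real (\<alpha> - \<beta>)) = w powi n"
      using w(1) by (simp add: n complex_powr_of_int)
    also have cnj_w: "cnj w powr (of_real \<beta>) = cnj (w powr (of_real \<beta>))"
      using \<open>Re w > 0\<close> by (simp add: cnj_powr)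
    also have "w powr (of_real \<beta>) * cnj (w powr (of_real \<beta>)) = of_real (((cmod w)\<^sup>2) powr \<beta>)"
      by (simp add: norm_powr_real_powr' powr_power powr_powr mult.commute
               flip: complex_norm_square powr_numeral)
    finally show ?thesis
      using cnj_w by (simp add: w_def zpow_def n)
  qed
  ultimately show ?thesis
    by (simp add: algebra_simps case_prod_unfold)
qed

section \<open>Uniqueness of series with real exponents\<close>

text \<open>
  If the weights \<open>w k\<close> are bounded by 1, equal 1 at \<open>i0\<close>, tend to 0 elsewhere and annihilate an
  absolutely summable family, then the family vanishes at \<open>i0\<close>, by dominated convergence.
\<close>

lemma has_sum_peak_zero:
  fixes b :: "'i \<Rightarrow> complex" and w :: "nat \<Rightarrow> 'i \<Rightarrow> complex"
  assumes b: "b summable_on UNIV"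
    and sum0: "\<And>k. ((\<lambda>i. b i * w k i) has_sum 0) UNIV"
    and bound: "\<And>k i. b i \<noteq> 0 \<Longrightarrow> norm (w k i) \<le> 1"
    and peak: "\<And>k. w k i0 = 1"
    and lim: "\<And>i. b i \<noteq> 0 \<Longrightarrow> i \<noteq> i0 \<Longrightarrow> (\<lambda>k. w k i) \<longlonglongrightarrow> 0"
  shows "b i0 = 0"
proof -
  have ab: "(\<lambda>i. norm (b i)) summable_on A" for A
    using b by (auto simp: summable_on_iff_abs_summable_on_complex intro: summable_on_subset_banach)
  have "norm (b i0) \<le> \<epsilon>" if \<epsilon>: "\<epsilon> > 0" for \<epsilon>
  proof -
    obtain S where S: "finite S" "dist (\<Sum>i\<in>S. norm (b i)) (infsum (\<lambda>i. norm (b i)) UNIV) \<le> \<epsilon>"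
      using has_sum_finite_approximation[OF has_sum_infsum[OF ab] \<epsilon>] by auto
    define T where "T = insert i0 S"
    have T: "finite T" using S by (simp add: T_def)
    have tail: "infsum (\<lambda>i. norm (b i)) (- T) \<le> \<epsilon>"
    proof -
      have "infsum (\<lambda>i. norm (b i)) UNIV = infsum (\<lambda>i. norm (b i)) (T \<union> - T)"
        by simp
      also have "\<dots> = (\<Sum>i\<in>T. norm (b i)) + infsum (\<lambda>i. norm (b i)) (- T)"
        using ab T by (subst infsum_Un_disjoint) auto
      finally have "(\<Sum>i\<in>T. norm (b i)) + infsum (\<lambda>i. norm (b i)) (- T)
          = infsum (\<lambda>i. norm (b i)) UNIV" ..
      moreover have "(\<Sum>i\<in>S. norm (b i)) \<le> (\<Sum>i\<in>T. norm (b i))"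
        by (rule sum_mono2) (auto simp: T_def S(1))
      ultimately show ?thesis using S(2) by (simp add: dist_real_def)
    qed
    have le: "norm (b i0) \<le> (\<Sum>i\<in>T - {i0}. norm (b i * w k i)) + \<epsilon>" for k
    proof -
      have sm: "(\<lambda>i. b i * w k i) summable_on A" for A
        using sum0[of k] has_sum_imp_summable summable_on_subset_banach by blast
      have "0 = infsum (\<lambda>i. b i * w k i) (T \<union> - T)"
        using infsumI[OF sum0[of k]] by simp
      also have "\<dots> = (\<Sum>i\<in>T. b i * w k i) + infsum (\<lambda>i. b i * w k i) (- T)"
        using sm T by (subst infsum_Un_disjoint) auto
      also have "(\<Sum>i\<in>T. b i * w k i) = b i0 + (\<Sum>i\<in>T - {i0}. b i * w k i)"
        using peak by (subst sum.remove[OF T, of i0]) (auto simp: T_def)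
      finally have eq: "b i0 = - ((\<Sum>i\<in>T - {i0}. b i * w k i) + infsum (\<lambda>i. b i * w k i) (- T))"
        by (simp add: add_eq_0_iff add.assoc)
      then have "norm (b i0) \<le> norm (\<Sum>i\<in>T - {i0}. b i * w k i) + norm (infsum (\<lambda>i. b i * w k i) (- T))"
        by (subst eq) (simp only: norm_minus_cancel norm_triangle_ineq)
      moreover have "norm (infsum (\<lambda>i. b i * w k i) (- T)) \<le> infsum (\<lambda>i. norm (b i)) (- T)"
      proof (rule norm_infsum_le[OF has_sum_infsum has_sum_infsum])
        show "norm (b i * w k i) \<le> norm (b i)" for i
          using bound[of i k] by (cases "b i = 0") (auto simp: norm_mult mult_left_le)
      qed (use ab sm in auto)
      ultimately show ?thesis
        using tail norm_sum[of "\<lambda>i. b i * w k i" "T - {i0}"] by linarith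
    qed
    have "(\<lambda>k. (\<Sum>i\<in>T - {i0}. norm (b i * w k i)) + \<epsilon>) \<longlonglongrightarrow> (\<Sum>i\<in>T - {i0}. 0) + \<epsilon>"
    proof (intro tendsto_add tendsto_sum tendsto_const)
      fix i assume "i \<in> T - {i0}"
      then show "(\<lambda>k. norm (b i * w k i)) \<longlonglongrightarrow> 0"
        using lim[of i] by (cases "b i = 0") (auto intro!: tendsto_norm_zero tendsto_mult_right_zero)
    qed
    then show ?thesis
      using le by (intro LIMSEQ_le_const[of _ \<epsilon>]) auto
  qed
  then have "norm (b i0) \<le> 0" by (rule field_le_epsilon) simp
  then show ?thesis by simp
qed

text \<open>
  The exponents may be dense, so there need not be a lowest term to compare. Instead, multiplying
  the coefficients by \<open>x\<^sup>r xbar\<^sup>s\<close> with \<open>0 < \<bar>x\<bar> \<le> 1\<close> amounts to replacing \<open>p\<close> by \<open>x p\<close>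
  and preserves the hypothesis. Products of linear combinations of such multipliers provide weights that
  peak at a given exponent.
\<close>

lemma formal_series_bdd_zero:
  assumes A: "A \<in> formal_series_bdd" and "R > 0"
    and zero: "\<And>p. 0 < norm p \<Longrightarrow> norm p < R \<Longrightarrow> ((\<lambda>(r, s). A r s * zpow r s p) has_sum 0) UNIV"
  shows "A r0 s0 = 0"
proof (cases "A r0 s0 = 0")
  case False
  obtain N where N: "\<And>r s. A r s \<noteq> 0 \<Longrightarrow> r \<ge> N \<and> s \<ge> N"
    and int: "\<And>r s. A r s \<noteq> 0 \<Longrightarrow> r - s \<in> \<int>"
    using A by (auto simp: formal_series_bdd_def formal_series_def)
  \<comment> \<open>the weights under which the series still sums to \<open>0\<close>\<close>
  define G where "G = {w :: real \<times> real \<Rightarrow> complex.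
    \<forall>p. 0 < norm p \<longrightarrow> norm p < R \<longrightarrow> ((\<lambda>(r, s). A r s * w (r, s) * zpow r s p) has_sum 0) UNIV}"
  have G_1: "(\<lambda>_. 1) \<in> G"
    using zero by (simp add: G_def)
  have G_add: "(\<lambda>i. w i + w' i) \<in> G" if "w \<in> G" "w' \<in> G" for w w'
    unfolding G_def
  proof safe
    fix p :: complex assume "0 < norm p" "norm p < R"
    then show "((\<lambda>(r, s). A r s * (w (r, s) + w' (r, s)) * zpow r s p) has_sum 0) UNIV"
      using that has_sum_add[where f = "\<lambda>(r, s). A r s * w (r, s) * zpow r s p" and A = UNIV and a = 0
          and g = "\<lambda>(r, s). A r s * w' (r, s) * zpow r s p" and b = 0]
      by (simp add: G_def case_prod_unfold algebra_simps)
  qed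
  have G_scale: "(\<lambda>i. c * w i) \<in> G" if "w \<in> G" for w c
    unfolding G_def
  proof safe
    fix p :: complex assume "0 < norm p" "norm p < R"
    then show "((\<lambda>(r, s). A r s * (c * w (r, s)) * zpow r s p) has_sum 0) UNIV"
      using that has_sum_cmult_right[where f = "\<lambda>(r, s). A r s * w (r, s) * zpow r s p" and A = UNIV and a = 0 and c = c]
      by (simp add: G_def case_prod_unfold algebra_simps)
  qed
  have G_zpow: "(\<lambda>i. w i * zpow (fst i) (snd i) x) \<in> G"
    if "w \<in> G" and x: "x \<noteq> 0" "norm x \<le> 1" for w x
    unfolding G_def
  proof safe
    fix p :: complex assume p: "0 < norm p" "norm p < R"
    then have "0 < norm (x * p)" "norm (x * p) < R"
      using x mult_left_le_one_le[of "norm p" "norm x"] le_less_trans[of "norm x * norm p" "norm p" R]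
      by (auto simp: norm_mult)
    then have "((\<lambda>(r, s). A r s * w (r, s) * zpow r s (x * p)) has_sum 0) UNIV"
      using that(1) by (simp only: G_def mem_Collect_eq)
    then show "((\<lambda>(r, s). A r s * (w (r, s) * zpow (fst (r, s)) (snd (r, s)) x) * zpow r s p) has_sum 0) UNIV"
      by (simp add: zpow_mult mult.assoc)
  qed
  \<comment> \<open>The factor \<open>ang l\<close> is \<open>1\<close> if \<open>r - s = r0 - s0\<close> and \<open>0\<close> if these differ by \<open>l + 1\<close>. The factor
    \<open>rad\<close> is \<open>1\<close> if \<open>r + s = r0 + s0\<close> and otherwise of modulus less than \<open>1\<close>, because
    \<open>exp (2 * N - (r + s))\<close> lies between \<open>0\<close> and \<open>1\<close>.\<close>
  define ang :: "nat \<Rightarrow> real \<times> real \<Rightarrow> complex" where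
    "ang l = (\<lambda>(r, s). (1 + cis (- (r0 - s0) * (pi / real (Suc l))) * zpow r s (cis (pi / real (Suc l)))) / 2)" for l
  define y where "y = complex_of_real (exp (- 1))"
  define \<rho>0 where "\<rho>0 = exp (2 * N - (r0 + s0))"
  define rad :: "real \<times> real \<Rightarrow> complex" where
    "rad = (\<lambda>(r, s). 1 - (of_real (exp (2 * N)) * zpow r s y - of_real \<rho>0)\<^sup>2)"
  have ang_eq: "ang l (r, s) = (1 + cis ((r - s - (r0 - s0)) * (pi / real (Suc l)))) / 2"
    if "r - s \<in> \<int>" for l r s
  proof -
    have "cis (- (r0 - s0) * \<theta>) * cis ((r - s) * \<theta>) = cis ((r - s - (r0 - s0)) * \<theta>)" for \<theta>
      by (simp add: cis_mult algebra_simps)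
    then show ?thesis
      using that by (simp only: ang_def zpow_cis case_prod_conv)
  qed
  have rad_eq: "rad (r, s) = of_real (1 - (exp (2 * N - (r + s)) - \<rho>0)\<^sup>2)" if "r - s \<in> \<int>" for r s
  proof -
    have "exp (2 * N) * exp ((r + s) * - 1) = exp (2 * N - (r + s))"
      by (simp flip: exp_add)
    then show ?thesis
      unfolding rad_def y_def case_prod_conv zpow_exp[OF that]
      by (simp only: of_real_diff of_real_power of_real_1 flip: of_real_mult)
  qed
  have G_ang: "(\<lambda>i. w i * ang l i) \<in> G" if "w \<in> G" for w l
  proof -
    have "(\<lambda>i. (1/2) * w i + (1/2 * cis (- (r0 - s0) * (pi / real (Suc l)))) *
        (w i * zpow (fst i) (snd i) (cis (pi / real (Suc l))))) \<in> G"
      using that by (intro G_add G_scale G_zpow) auto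
    also have "(\<lambda>i. (1/2) * w i + (1/2 * cis (- (r0 - s0) * (pi / real (Suc l)))) *
        (w i * zpow (fst i) (snd i) (cis (pi / real (Suc l))))) = (\<lambda>i. w i * ang l i)"
      by (simp add: ang_def fun_eq_iff field_simps)
    finally show ?thesis .
  qed
  have G_rad: "(\<lambda>i. w i * rad i) \<in> G" if "w \<in> G" for w
  proof -
    define c where "c = complex_of_real (exp (2 * N))"
    have y: "y \<noteq> 0" "norm y \<le> 1" by (auto simp: y_def)
    have "(\<lambda>i. (1 - of_real \<rho>0 ^ 2) * w i + (2 * of_real \<rho>0 * c) * (w i * zpow (fst i) (snd i) y)
        + (- (c ^ 2)) * ((w i * zpow (fst i) (snd i) y) * zpow (fst i) (snd i) y)) \<in> G"
      using that y by (intro G_add G_scale G_zpow) auto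
    also have "(\<lambda>i. (1 - of_real \<rho>0 ^ 2) * w i + (2 * of_real \<rho>0 * c) * (w i * zpow (fst i) (snd i) y)
        + (- (c ^ 2)) * ((w i * zpow (fst i) (snd i) y) * zpow (fst i) (snd i) y)) = (\<lambda>i. w i * rad i)"
      by (simp add: rad_def c_def fun_eq_iff power2_eq_square algebra_simps)
    finally show ?thesis .
  qed
  define w where "w k i = (\<Prod>l<k. ang l i * rad i)" for k i
  have w: "w k \<in> G" for k
  proof (induction k)
    case (Suc k)
    have "w (Suc k) = (\<lambda>i. (w k i * ang k i) * rad i)"
      by (simp add: w_def fun_eq_iff mult_ac)
    then show ?case using G_rad[OF G_ang[OF Suc]] by simp
  qed (use G_1 in \<open>simp add: w_def[abs_def]\<close>)
  have \<rho>_le: "0 < exp (2 * N - (r + s))" "exp (2 * N - (r + s)) \<le> 1" if "A r s \<noteq> 0" for r s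
    using N[OF that] by auto
  have norm_ang: "norm (ang l (r, s)) \<le> 1" if "A r s \<noteq> 0" for l r s
    using int[OF that] norm_triangle_ineq[of 1 "cis ((r - s - (r0 - s0)) * (pi / real (Suc l)))"]
    by (simp add: ang_eq norm_divide)
  have norm_rad: "norm (rad (r, s)) \<le> 1" "s + r \<noteq> s0 + r0 \<Longrightarrow> norm (rad (r, s)) < 1"
    if "A r s \<noteq> 0" for r s
  proof -
    define d where "d = exp (2 * N - (r + s)) - \<rho>0"
    have "\<bar>d\<bar> \<le> 1"
      using \<rho>_le[OF that] \<rho>_le[OF False] unfolding d_def \<rho>0_def by linarith
    then have d: "d\<^sup>2 \<le> 1" by (simp add: abs_square_le_1)
    have "d \<noteq> 0" if "s + r \<noteq> s0 + r0"
      using that by (auto simp: d_def \<rho>0_def)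
    then have d': "0 < d\<^sup>2" if "s + r \<noteq> s0 + r0"
      using that by simp
    have "norm (rad (r, s)) = 1 - d\<^sup>2"
      using int[OF that] d by (simp add: rad_eq d_def del: of_real_diff of_real_power)
    then show "norm (rad (r, s)) \<le> 1" "s + r \<noteq> s0 + r0 \<Longrightarrow> norm (rad (r, s)) < 1"
      using d' by auto
  qed
  obtain p :: complex where p: "0 < norm p" "norm p < R"
    using \<open>R > 0\<close> by (intro that[of "of_real (R / 2)"]) auto
  have "(\<lambda>(r, s). A r s * zpow r s p) (r0, s0) = 0"
  proof (rule has_sum_peak_zero[where w = w])
    show "(\<lambda>(r, s). A r s * zpow r s p) summable_on UNIV"
      using zero[OF p] by (rule has_sum_imp_summable)
    show "((\<lambda>i. (case i of (r, s) \<Rightarrow> A r s * zpow r s p) * w k i) has_sum 0) UNIV" for k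
      using w[of k] p by (simp add: G_def case_prod_unfold mult_ac)
    show "norm (w k i) \<le> 1" if "(case i of (r, s) \<Rightarrow> A r s * zpow r s p) \<noteq> 0" for k i
    proof -
      obtain r s where [simp]: "i = (r, s)" by (cases i)
      have "A r s \<noteq> 0" using that by auto
      then show ?thesis
        using norm_ang norm_rad unfolding w_def prod_norm[symmetric]
        by (intro prod_le_1) (auto simp: norm_mult intro!: mult_le_one)
    qed
    show "w k (r0, s0) = 1" for k
      using int[OF False] by (simp add: w_def ang_eq rad_eq \<rho>0_def)
    show "(\<lambda>k. w k i) \<longlonglongrightarrow> 0"
      if "(case i of (r, s) \<Rightarrow> A r s * zpow r s p) \<noteq> 0" "i \<noteq> (r0, s0)" for i
    proof -
      obtain r s where [simp]: "i = (r, s)" by (cases i)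
      have A_nz: "A r s \<noteq> 0" using that by auto
      show ?thesis
      proof (cases "r - s = r0 - s0")
        case True
        with that have "s + r \<noteq> s0 + r0" by auto
        then have lt: "norm (rad i) < 1" using norm_rad A_nz by simp
        have "norm (w k i) \<le> norm (rad i) ^ k" for k
        proof -
          have "norm (w k i) \<le> (\<Prod>l<k. norm (rad i))"
            unfolding w_def prod_norm[symmetric] using norm_ang[OF A_nz]
            by (intro prod_mono) (auto simp: norm_mult intro!: mult_left_le_one_le)
          then show ?thesis by simp
        qed
        then show ?thesis
          by (intro Lim_null_comparison[OF always_eventually LIMSEQ_power_zero[of "norm (rad i)"]])
             (use lt in auto)
      next
        case False
        obtain d where d: "r - s - (r0 - s0) = of_int d"
          using Ints_diff[OF int[OF A_nz] int[OF \<open>A r0 s0 \<noteq> 0\<close>]] by (auto elim!: Ints_cases)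
        then have "d \<noteq> 0" using False by auto
        define L where "L = nat \<bar>d\<bar> - 1"
        have L: "real (Suc L) = \<bar>of_int d\<bar>"
          using \<open>d \<noteq> 0\<close> by (simp add: L_def)
        then have "(r - s - (r0 - s0)) * (pi / real (Suc L)) \<in> {pi, - pi}"
          using \<open>d \<noteq> 0\<close> d by (simp add: abs_if)
        then have "ang L i = 0"
          using int[OF A_nz] by (auto simp: ang_eq simp flip: cis_cnj)
        then have "w k i = 0" if "k > L" for k
          unfolding w_def using that by (intro prod_zero) auto
        then have "eventually (\<lambda>k. w k i = 0) sequentially"
          by (rule eventually_mono[OF eventually_gt_at_top[of L]])
        then show ?thesis by (rule tendsto_eventually)
      qed
    qed
  qed
  moreover have "zpow r0 s0 p \<noteq> 0"
    using p by (auto simp: zpow_def)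
  ultimately show ?thesis by simp
qed simp

lemma formal_series_bdd_diff:
  fixes A B :: "real \<Rightarrow> real \<Rightarrow> complex"
  assumes "A \<in> formal_series_bdd" "B \<in> formal_series_bdd"
  shows "(\<lambda>r s. A r s - B r s) \<in> formal_series_bdd"
proof -
  obtain M N where MN: "\<And>r s. A r s \<noteq> 0 \<Longrightarrow> r \<ge> M \<and> s \<ge> M" "\<And>r s. B r s \<noteq> 0 \<Longrightarrow> r \<ge> N \<and> s \<ge> N"
    and fs: "countable {(r, s). A r s \<noteq> 0}" "countable {(r, s). B r s \<noteq> 0}"
    "\<And>r s. A r s \<noteq> 0 \<Longrightarrow> r - s \<in> \<int>" "\<And>r s. B r s \<noteq> 0 \<Longrightarrow> r - s \<in> \<int>"
    using assms by (auto simp: formal_series_bdd_def formal_series_def)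
  have *: "A r s \<noteq> 0 \<or> B r s \<noteq> 0" if "A r s - B r s \<noteq> 0" for r s
    using that by auto
  have "countable {(r, s). A r s - B r s \<noteq> 0}"
    by (rule countable_subset[OF _ countable_Un[OF fs(1,2)]]) auto
  moreover have "r \<ge> min M N \<and> s \<ge> min M N" if "A r s - B r s \<noteq> 0" for r s
    using *[OF that] MN by (meson min.coboundedI1 min.coboundedI2)
  moreover have "r - s \<in> \<int>" if "A r s - B r s \<noteq> 0" for r s
    using *[OF that] fs(3,4) by blast
  ultimately show ?thesis
    unfolding formal_series_bdd_def formal_series_def by blast
qed

lemma formal_series_bdd_eqI:
  assumes "A \<in> formal_series_bdd" "B \<in> formal_series_bdd" "R > 0"
    and "\<And>p. 0 < norm p \<Longrightarrow> norm p < R \<Longrightarrow> ((\<lambda>(r, s). A r s * zpow r s p) has_sum g p) UNIV"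
    and "\<And>p. 0 < norm p \<Longrightarrow> norm p < R \<Longrightarrow> ((\<lambda>(r, s). B r s * zpow r s p) has_sum g p) UNIV"
  shows "A = B"
proof -
  have "A r s - B r s = 0" for r s
  proof (rule formal_series_bdd_zero[OF formal_series_bdd_diff[OF assms(1,2)] \<open>R > 0\<close>])
    fix p :: complex assume "0 < norm p" "norm p < R"
    from has_sum_add[OF assms(4)[OF this] has_sum_uminusI[OF assms(5)[OF this]]]
    show "((\<lambda>(r, s). (A r s - B r s) * zpow r s p) has_sum 0) UNIV"
      by (simp add: case_prod_unfold algebra_simps)
  qed
  then show ?thesis by (simp add: fun_eq_iff)
qed

section \<open>An identity theorem for real analytic functions\<close>

text \<open>
  Analyticity along the two coordinate axes, uniformly near \<open>z\<close>: on each horizontal and vertical segment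
  through the square of half-width \<open>\<rho>\<close> about \<open>z\<close>, the function is the restriction of a function
  that is holomorphic in the disc of radius \<open>\<rho>\<close>. This is implied by real analyticity, is visibly closed under sums and
  products, and still forces the identity theorem.
\<close>

definition axis_analytic_at :: "(complex \<Rightarrow> complex) \<Rightarrow> complex \<Rightarrow> real \<Rightarrow> bool" where
  "axis_analytic_at f z \<rho> \<longleftrightarrow> (\<forall>t. \<bar>t\<bar> < \<rho> \<longrightarrow>
     (\<exists>g. g holomorphic_on ball 0 \<rho> \<and> (\<forall>x. \<bar>x\<bar> < \<rho> \<longrightarrow> f (z + Complex x t) = g (of_real x))) \<and>
     (\<exists>g. g holomorphic_on ball 0 \<rho> \<and> (\<forall>y. \<bar>y\<bar> < \<rho> \<longrightarrow> f (z + Complex t y) = g (of_real y))))"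

definition axis_analytic_on :: "(complex \<Rightarrow> complex) \<Rightarrow> complex set \<Rightarrow> bool" where
  "axis_analytic_on f U \<longleftrightarrow> (\<forall>z\<in>U. \<exists>\<rho>>0. axis_analytic_at f z \<rho>)"

lemma axis_analytic_at_mono:
  assumes "axis_analytic_at f z \<rho>" "\<rho>' \<le> \<rho>"
  shows "axis_analytic_at f z \<rho>'"
  unfolding axis_analytic_at_def
proof (intro allI impI)
  fix t :: real assume "\<bar>t\<bar> < \<rho>'"
  with assms(2) have t: "\<bar>t\<bar> < \<rho>" by linarith
  then obtain g h where gh: "g holomorphic_on ball 0 \<rho>" "\<forall>x. \<bar>x\<bar> < \<rho> \<longrightarrow> f (z + Complex x t) = g (of_real x)"
    "h holomorphic_on ball 0 \<rho>" "\<forall>y. \<bar>y\<bar> < \<rho> \<longrightarrow> f (z + Complex t y) = h (of_real y)"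
    using assms(1) unfolding axis_analytic_at_def by metis
  then show "(\<exists>g. g holomorphic_on ball 0 \<rho>' \<and> (\<forall>x. \<bar>x\<bar> < \<rho>' \<longrightarrow> f (z + Complex x t) = g (of_real x))) \<and>
     (\<exists>g. g holomorphic_on ball 0 \<rho>' \<and> (\<forall>y. \<bar>y\<bar> < \<rho>' \<longrightarrow> f (z + Complex t y) = g (of_real y)))"
    using assms(2) by (intro conjI exI[of _ g] exI[of _ h])
      (auto intro: holomorphic_on_subset[OF _ subset_ball])
qed

lemma axis_analytic_on_binop:
  assumes f: "axis_analytic_on f U" and g: "axis_analytic_on g U"
    and op: "\<And>F G r. F holomorphic_on ball 0 r \<Longrightarrow> G holomorphic_on ball 0 r \<Longrightarrow>
      (\<lambda>x. op (F x) (G x)) holomorphic_on ball 0 r"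
  shows "axis_analytic_on (\<lambda>p. op (f p) (g p)) U"
  unfolding axis_analytic_on_def
proof
  fix z assume "z \<in> U"
  then obtain r r' where r: "r > 0" "axis_analytic_at f z r" "r' > 0" "axis_analytic_at g z r'"
    using f g unfolding axis_analytic_on_def by blast
  define \<rho> where "\<rho> = min r r'"
  have \<rho>: "axis_analytic_at f z \<rho>" "axis_analytic_at g z \<rho>"
    using r by (auto simp: \<rho>_def intro: axis_analytic_at_mono)
  have "axis_analytic_at (\<lambda>p. op (f p) (g p)) z \<rho>"
    unfolding axis_analytic_at_def
  proof (intro allI impI conjI)
    fix t :: real assume t: "\<bar>t\<bar> < \<rho>"
    show "\<exists>h. h holomorphic_on ball 0 \<rho> \<and> (\<forall>x. \<bar>x\<bar> < \<rho> \<longrightarrow>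
        op (f (z + Complex x t)) (g (z + Complex x t)) = h (of_real x))"
    proof -
      obtain F G where "F holomorphic_on ball 0 \<rho>" "\<forall>x. \<bar>x\<bar> < \<rho> \<longrightarrow> f (z + Complex x t) = F (of_real x)"
        "G holomorphic_on ball 0 \<rho>" "\<forall>x. \<bar>x\<bar> < \<rho> \<longrightarrow> g (z + Complex x t) = G (of_real x)"
        using \<rho> t unfolding axis_analytic_at_def by metis
      then show ?thesis by (intro exI[of _ "\<lambda>x. op (F x) (G x)"]) (auto intro: op)
    qed
    show "\<exists>h. h holomorphic_on ball 0 \<rho> \<and> (\<forall>y. \<bar>y\<bar> < \<rho> \<longrightarrow>
        op (f (z + Complex t y)) (g (z + Complex t y)) = h (of_real y))"
    proof -
      obtain F G where "F holomorphic_on ball 0 \<rho>" "\<forall>y. \<bar>y\<bar> < \<rho> \<longrightarrow> f (z + Complex t y) = F (of_real y)"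
        "G holomorphic_on ball 0 \<rho>" "\<forall>y. \<bar>y\<bar> < \<rho> \<longrightarrow> g (z + Complex t y) = G (of_real y)"
        using \<rho> t unfolding axis_analytic_at_def by metis
      then show ?thesis by (intro exI[of _ "\<lambda>x. op (F x) (G x)"]) (auto intro: op)
    qed
  qed
  then show "\<exists>\<rho>>0. axis_analytic_at (\<lambda>p. op (f p) (g p)) z \<rho>"
    using r by (intro exI[of _ \<rho>]) (auto simp: \<rho>_def)
qed

lemma axis_analytic_on_const: "axis_analytic_on (\<lambda>_. c) U"
  unfolding axis_analytic_on_def axis_analytic_at_def
  by (intro ballI exI[of _ "1::real"] conjI allI impI exI[of _ "\<lambda>_. c"]) auto

lemmas axis_analytic_on_add = axis_analytic_on_binop[where op = "(+)", OF _ _ holomorphic_on_add]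
lemmas axis_analytic_on_diff = axis_analytic_on_binop[where op = "(-)", OF _ _ holomorphic_on_diff]
lemmas axis_analytic_on_mult = axis_analytic_on_binop[where op = "(*)", OF _ _ holomorphic_on_mult]

lemma axis_analytic_on_sum:
  "(\<And>i. i \<in> I \<Longrightarrow> axis_analytic_on (f i) U) \<Longrightarrow> axis_analytic_on (\<lambda>p. \<Sum>i\<in>I. f i p) U"
  by (induction I rule: infinite_finite_induct)
     (auto intro: axis_analytic_on_const axis_analytic_on_add)

lemma axis_analytic_on_subset: "axis_analytic_on f U \<Longrightarrow> V \<subseteq> U \<Longrightarrow> axis_analytic_on f V"
  by (auto simp: axis_analytic_on_def)

text \<open>
  On the line through \<open>c\<close> with direction \<open>e\<close> one has
  \<open>\<bar>c + x e\<bar>\<^sup>2 = \<bar>c\<bar>\<^sup>2 (1 + x e/c) (1 + x ebar/cbar)\<close>, whose right-hand side is holomorphic in \<open>x\<close>.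
\<close>

lemma zpow_line_holomorphic:
  assumes "r - s \<in> \<int>" "norm e = 1" "\<rho> \<le> norm c"
  shows "\<exists>g. g holomorphic_on ball 0 \<rho> \<and>
    (\<forall>x. \<bar>x\<bar> < \<rho> \<longrightarrow> zpow r s (c + of_real x * e) = g (of_real x))"
proof (cases "c = 0")
  case True
  then show ?thesis using assms(3) by (intro exI[of _ "\<lambda>_. 0"]) auto
next
  case c: False
  obtain n where n: "r - s = of_int n" using assms(1) by (auto elim!: Ints_cases)
  define q where "q x = x * (e / c)" for x
  define q' where "q' x = x * cnj (e / c)" for x
  have norm_q: "norm (q x) < 1" "norm (q' x) < 1" if "x \<in> ball 0 \<rho>" for x
    using that assms c by (auto simp: q_def q'_def norm_mult norm_divide divide_simps)
  have slit: "1 + u \<notin> \<real>\<^sub>\<le>\<^sub>0" "1 + u \<noteq> 0" if "norm u < 1" for u :: complex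
  proof -
    have "Re (1 + u) > 0" using that abs_Re_le_cmod[of u] by simp
    then show "1 + u \<notin> \<real>\<^sub>\<le>\<^sub>0" by (auto simp: complex_nonpos_Reals_iff)
    then show "1 + u \<noteq> 0" by auto
  qed
  define g where "g x = c powi n * (1 + q x) powi n *
    (of_real ((cmod c)\<^sup>2 powr s) * exp (of_real s * (Ln (1 + q x) + Ln (1 + q' x))))" for x
  have "g holomorphic_on ball 0 \<rho>"
    unfolding g_def
    by (intro holomorphic_intros) (use norm_q slit in \<open>auto simp: q_def q'_def intro!: holomorphic_intros\<close>)
  moreover have "zpow r s (c + of_real x * e) = g (of_real x)" if "\<bar>x\<bar> < \<rho>" for x
  proof -
    define v where "v = 1 + q (of_real x)"
    have v: "v \<noteq> 0" "v \<notin> \<real>\<^sub>\<le>\<^sub>0"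
      using slit[OF norm_q(1)[of "of_real x"]] that by (auto simp: v_def)
    have "1 + q' (of_real x) = cnj v" by (simp add: v_def q_def q'_def)
    then have "Ln v + Ln (1 + q' (of_real x)) = Ln v + cnj (Ln v)"
      using v by (simp add: cnj_Ln)
    also have "\<dots> = of_real (2 * ln (cmod v))"
      using v by (simp add: complex_add_cnj)
    finally have "exp (of_real s * (Ln v + Ln (1 + q' (of_real x)))) = of_real (exp (s * (2 * ln (cmod v))))"
      by (metis exp_of_real of_real_mult)
    also have "exp (s * (2 * ln (cmod v))) = (cmod v)\<^sup>2 powr s"
      using v by (simp add: powr_def ln_realpow)
    finally have "g (of_real x) = zpow r s c * zpow r s v"
      by (simp add: g_def zpow_def n v_def)
    also have "\<dots> = zpow r s (c * v)" by (simp add: zpow_mult)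
    also have "c * v = c + of_real x * e" using c by (simp add: v_def q_def algebra_simps)
    finally show ?thesis ..
  qed
  ultimately show ?thesis by blast
qed

lemma axis_analytic_on_zpow:
  assumes "r - s \<in> \<int>"
  shows "axis_analytic_on (\<lambda>p. zpow r s (p - a)) (- {a})"
  unfolding axis_analytic_on_def
proof
  fix z assume z: "z \<in> - {a}"
  define \<rho> where "\<rho> = norm (z - a) / 2"
  have "axis_analytic_at (\<lambda>p. zpow r s (p - a)) z \<rho>"
    unfolding axis_analytic_at_def
  proof (intro allI impI conjI)
    fix t :: real assume t: "\<bar>t\<bar> < \<rho>"
    have "\<rho> \<le> norm (z - a + \<i> * of_real t)" "\<rho> \<le> norm (z - a + of_real t)"
      using t norm_diff_ineq[of "z - a" "\<i> * of_real t"] norm_diff_ineq[of "z - a" "of_real t"]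
      by (auto simp: \<rho>_def norm_mult)
    from zpow_line_holomorphic[OF assms _ this(1), of 1] zpow_line_holomorphic[OF assms _ this(2), of \<i>]
    show "\<exists>g. g holomorphic_on ball 0 \<rho> \<and> (\<forall>x. \<bar>x\<bar> < \<rho> \<longrightarrow> zpow r s (z + Complex x t - a) = g (of_real x))"
      and "\<exists>g. g holomorphic_on ball 0 \<rho> \<and> (\<forall>y. \<bar>y\<bar> < \<rho> \<longrightarrow> zpow r s (z + Complex t y - a) = g (of_real y))"
      by (simp_all add: Complex_eq algebra_simps)
  qed
  then show "\<exists>\<rho>>0. axis_analytic_at (\<lambda>p. zpow r s (p - a)) z \<rho>"
    using z by (intro exI[of _ \<rho>]) (auto simp: \<rho>_def)
qed

lemma double_power_series_holomorphic:
  fixes c :: "nat \<Rightarrow> nat \<Rightarrow> complex"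
  assumes "\<And>x. \<bar>x\<bar> < \<rho> \<Longrightarrow> ((\<lambda>(m, n). c m n * of_real x ^ m * of_real t ^ n) has_sum h x) UNIV"
  shows "\<exists>g. g holomorphic_on ball 0 \<rho> \<and> (\<forall>x. \<bar>x\<bar> < \<rho> \<longrightarrow> h x = g (of_real x))"
proof (cases "\<rho> > 0")
  case True
  define g where "g w = infsum (\<lambda>(m, n). c m n * w ^ m * of_real t ^ n) UNIV" for w
  have sm: "(\<lambda>(m, n). c m n * w ^ m * of_real t ^ n) summable_on UNIV" if "norm w < \<rho>" for w
  proof -
    have "(\<lambda>(m, n). c m n * of_real (norm w) ^ m * of_real t ^ n) summable_on UNIV"
      using assms[of "norm w"] that by (auto dest: has_sum_imp_summable)
    then have "(\<lambda>z. norm (case z of (m, n) \<Rightarrow> c m n * w ^ m * of_real t ^ n)) summable_on UNIV"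
      unfolding summable_on_iff_abs_summable_on_complex
      by (simp add: case_prod_unfold norm_mult norm_power)
    then show ?thesis by (rule abs_summable_summable)
  qed
  have inner: "(\<lambda>n. c m n * of_real t ^ n) summable_on UNIV" for m
  proof -
    have "(\<lambda>(m, n). c m n * of_real (\<rho> / 2) ^ m * of_real t ^ n) summable_on UNIV \<times> UNIV"
      using sm[of "of_real (\<rho> / 2)"] True by simp
    from summable_on_SigmaD1[OF this, of m]
    have "(\<lambda>n. of_real (\<rho> / 2) ^ m * (c m n * of_real t ^ n)) summable_on UNIV"
      by (simp add: mult_ac)
    then show ?thesis using True by (subst (asm) summable_on_cmult_right') auto
  qed
  have sums: "(\<lambda>m. infsum (\<lambda>n. c m n * of_real t ^ n) UNIV * (w - 0) ^ m) sums g w"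
    if "w \<in> ball 0 \<rho>" for w
  proof (rule has_sum_imp_sums, rule has_sum_SigmaD)
    show "((\<lambda>(m, n). c m n * w ^ m * of_real t ^ n) has_sum g w) (UNIV \<times> UNIV)"
      using that sm[of w] by (simp add: g_def)
    show "((\<lambda>n. case (m, n) of (m, n) \<Rightarrow> c m n * w ^ m * of_real t ^ n) has_sum
        infsum (\<lambda>n. c m n * of_real t ^ n) UNIV * (w - 0) ^ m) UNIV" for m
      using has_sum_cmult_left[OF has_sum_infsum[OF inner[of m]], of "w ^ m"] by (simp add: mult_ac)
  qed
  have "g holomorphic_on ball 0 \<rho>"
    using sums by (rule power_series_holomorphic)
  moreover have "h x = g (of_real x)" if "\<bar>x\<bar> < \<rho>" for x
    using infsumI[OF assms[OF that]] by (simp add: g_def)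
  ultimately show ?thesis by blast
qed (auto intro!: exI[of _ "\<lambda>_. 0"])

lemma real_analytic_on_imp_axis_analytic_on:
  assumes "real_analytic_on f U"
  shows "axis_analytic_on f U"
  unfolding axis_analytic_on_def
proof
  fix z assume "z \<in> U"
  then obtain c \<rho> where \<rho>: "\<rho> > 0"
    and c: "\<And>w. cmod w < \<rho> \<Longrightarrow>
      ((\<lambda>(m, n). c m n * of_real (Re w) ^ m * of_real (Im w) ^ n) has_sum f (z + w)) UNIV"
    using assms unfolding real_analytic_on_def by blast
  have c': "((\<lambda>(m, n). c m n * of_real x ^ m * of_real y ^ n) has_sum f (z + Complex x y)) UNIV"
    if "\<bar>x\<bar> < \<rho> / 2" "\<bar>y\<bar> < \<rho> / 2" for x y
    using c[of "Complex x y"] cmod_le[of "Complex x y"] that by simp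
  have "axis_analytic_at f z (\<rho> / 2)"
    unfolding axis_analytic_at_def
  proof (intro allI impI conjI)
    fix t :: real assume t: "\<bar>t\<bar> < \<rho> / 2"
    show "\<exists>g. g holomorphic_on ball 0 (\<rho> / 2) \<and>
        (\<forall>x. \<bar>x\<bar> < \<rho> / 2 \<longrightarrow> f (z + Complex x t) = g (of_real x))"
      by (rule double_power_series_holomorphic) (rule c'[OF _ t])
    show "\<exists>g. g holomorphic_on ball 0 (\<rho> / 2) \<and>
        (\<forall>y. \<bar>y\<bar> < \<rho> / 2 \<longrightarrow> f (z + Complex t y) = g (of_real y))"
    proof (rule double_power_series_holomorphic)
      fix y :: real assume "\<bar>y\<bar> < \<rho> / 2"
      from c'[OF t this] have "((\<lambda>(m, n). c m n * of_real t ^ m * of_real y ^ n) has_sum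
          f (z + Complex t y)) (UNIV \<times> UNIV)"
        by simp
      then show "((\<lambda>(n, m). c m n * of_real y ^ n * of_real t ^ m) has_sum f (z + Complex t y)) UNIV"
        by (subst (asm) has_sum_swap) (simp add: case_prod_unfold mult_ac)
    qed
  qed
  then show "\<exists>\<rho>>0. axis_analytic_at f z \<rho>"
    using \<rho> by (intro exI[of _ "\<rho> / 2"]) auto
qed

lemma holomorphic_zero_on_real_interval:
  fixes g :: "complex \<Rightarrow> complex"
  assumes g: "g holomorphic_on ball 0 \<rho>" and "a < b"
    and ab: "\<And>x. a < x \<Longrightarrow> x < b \<Longrightarrow> \<bar>x\<bar> < \<rho> \<and> g (of_real x) = 0"
    and x: "\<bar>x\<bar> < \<rho>"
  shows "g (of_real x) = 0"
proof -
  define \<xi> where "\<xi> = (a + b) / 2"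
  have \<xi>: "a < \<xi>" "\<xi> < b" using \<open>a < b\<close> by (auto simp: \<xi>_def)
  show ?thesis
  proof (rule analytic_continuation[OF g, where U = "of_real ` {a<..<b}" and \<xi> = "of_real \<xi>"])
    have "\<xi> islimpt {a<..<b}"
      using \<xi> by (intro open_imp_islimpt) auto
    then obtain X where "\<And>n. X n \<in> {a<..<b} - {\<xi>}" "X \<longlonglongrightarrow> \<xi>"
      unfolding islimpt_sequential by blast
    then have "\<forall>n. complex_of_real (X n) \<in> of_real ` {a<..<b} - {of_real \<xi>}"
      "(\<lambda>n. complex_of_real (X n)) \<longlonglongrightarrow> of_real \<xi>"
      by (auto intro: tendsto_of_real)
    then show "complex_of_real \<xi> islimpt of_real ` {a<..<b}"
      unfolding islimpt_sequential by (intro exI[of _ "\<lambda>n. of_real (X n)"] conjI)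
  qed (use ab \<xi> x in auto)
qed

text \<open>
  A zero set with an interior point in the square about \<open>z\<close> contains first a horizontal strip of the square and then,
  along vertical segments, the whole square. Hence the interior of the zero set is closed in \<open>U\<close>.
\<close>

lemma axis_analytic_identity:
  assumes f: "axis_analytic_on f U" and U: "connected U" "open U"
    and V: "open V" "V \<noteq> {}" "V \<subseteq> U" "\<And>z. z \<in> V \<Longrightarrow> f z = 0"
    and z: "z \<in> U"
  shows "f z = 0"
proof -
  define Z where "Z = interior {z. f z = 0}"
  have box: "z \<in> Z" if at: "axis_analytic_at f z \<rho>" and w: "w \<in> Z" "dist z w < \<rho>" for z w \<rho>
  proof -
    define a where "a = Re (w - z)"
    define b where "b = Im (w - z)"
    have w_eq: "w = z + Complex a b" by (simp add: a_def b_def complex_eq_iff)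
    have ab: "\<bar>a\<bar> < \<rho>" "\<bar>b\<bar> < \<rho>"
      using w(2) abs_Re_le_cmod[of "w - z"] abs_Im_le_cmod[of "w - z"]
      by (auto simp: a_def b_def dist_norm norm_minus_commute)
    obtain \<epsilon>0 where \<epsilon>0: "\<epsilon>0 > 0" "\<And>v. dist w v < \<epsilon>0 \<Longrightarrow> f v = 0"
      using w(1) unfolding Z_def mem_interior by (auto simp: subset_iff)
    define \<epsilon> where "\<epsilon> = min (\<epsilon>0 / 2) (min (\<rho> - \<bar>a\<bar>) (\<rho> - \<bar>b\<bar>))"
    have \<epsilon>: "\<epsilon> > 0" "\<epsilon> \<le> \<epsilon>0 / 2" "\<epsilon> \<le> \<rho> - \<bar>a\<bar>" "\<epsilon> \<le> \<rho> - \<bar>b\<bar>"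
      using ab \<epsilon>0 unfolding \<epsilon>_def by linarith+
    have small: "f (z + Complex x y) = 0" if "\<bar>x - a\<bar> < \<epsilon>" "\<bar>y - b\<bar> < \<epsilon>" for x y
    proof -
      have "dist w (z + Complex x y) = cmod (Complex (x - a) (y - b))"
        by (subst dist_commute) (simp add: w_eq dist_norm complex_diff)
      also have "\<dots> \<le> \<bar>x - a\<bar> + \<bar>y - b\<bar>" using cmod_le[of "Complex (x - a) (y - b)"] by simp
      also have "\<dots> < \<epsilon>0" using that \<epsilon> by linarith
      finally show ?thesis by (rule \<epsilon>0(2))
    qed
    have strip: "f (z + Complex x y) = 0" if x: "\<bar>x\<bar> < \<rho>" and y: "\<bar>y - b\<bar> < \<epsilon>" for x y
    proof -
      have "\<bar>y\<bar> < \<rho>" using y \<epsilon> by linarith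
      then obtain g where g: "g holomorphic_on ball 0 \<rho>"
        "\<And>x. \<bar>x\<bar> < \<rho> \<Longrightarrow> f (z + Complex x y) = g (of_real x)"
        using at unfolding axis_analytic_at_def by metis
      have "g (of_real x) = 0"
      proof (rule holomorphic_zero_on_real_interval[OF g(1), of "a - \<epsilon>" "a + \<epsilon>"])
        fix x assume x: "a - \<epsilon> < x" "x < a + \<epsilon>"
        then have "\<bar>x\<bar> < \<rho>" using \<epsilon> by linarith
        moreover have "\<bar>x - a\<bar> < \<epsilon>" using x by linarith
        ultimately show "\<bar>x\<bar> < \<rho> \<and> g (of_real x) = 0"
          using g(2)[of x] small[of x y] y by simp
      qed (use \<epsilon> x in auto)
      then show ?thesis using g(2) x by simp
    qed
    have whole: "f (z + Complex x y) = 0" if x: "\<bar>x\<bar> < \<rho>" and y: "\<bar>y\<bar> < \<rho>" for x y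
    proof -
      obtain g where g: "g holomorphic_on ball 0 \<rho>"
        "\<And>y. \<bar>y\<bar> < \<rho> \<Longrightarrow> f (z + Complex x y) = g (of_real y)"
        using at x unfolding axis_analytic_at_def by metis
      have "g (of_real y) = 0"
      proof (rule holomorphic_zero_on_real_interval[OF g(1), of "b - \<epsilon>" "b + \<epsilon>"])
        fix y assume y: "b - \<epsilon> < y" "y < b + \<epsilon>"
        then have "\<bar>y\<bar> < \<rho>" using \<epsilon> by linarith
        moreover have "\<bar>y - b\<bar> < \<epsilon>" using y by linarith
        ultimately show "\<bar>y\<bar> < \<rho> \<and> g (of_real y) = 0"
          using g(2)[of y] strip[OF x, of y] by simp
      qed (use \<epsilon> y in auto)
      then show ?thesis using g(2) y by simp
    qed
    have "f v = 0" if "dist z v < \<rho>" for v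
    proof -
      have "cmod (v - z) < \<rho>" using that by (simp add: dist_norm norm_minus_commute)
      then have "f (z + Complex (Re (v - z)) (Im (v - z))) = 0"
        using abs_Re_le_cmod[of "v - z"] abs_Im_le_cmod[of "v - z"] by (intro whole) linarith+
      then show ?thesis by (simp only: complex_surj) simp
    qed
    moreover have "\<rho> > 0" using ab(1) by linarith
    ultimately show "z \<in> Z" unfolding Z_def mem_interior by (auto simp: subset_iff)
  qed
  have cover: "U \<subseteq> Z \<union> interior (- Z)"
  proof
    fix z assume z: "z \<in> U"
    show "z \<in> Z \<union> interior (- Z)"
    proof (rule ccontr)
      assume nz: "z \<notin> Z \<union> interior (- Z)"
      obtain \<rho> where \<rho>: "\<rho> > 0" "axis_analytic_at f z \<rho>"
        using f z by (auto simp: axis_analytic_on_def)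
      have "ball z \<rho> \<subseteq> - Z" using box[OF \<rho>(2)] nz by auto
      then show False using \<rho>(1) nz by (auto simp: mem_interior)
    qed
  qed
  have "Z \<inter> interior (- Z) \<inter> U = {}" using interior_subset by blast
  with cover connectedD[OF U(1), of Z "interior (- Z)"]
  have "Z \<inter> U = {} \<or> interior (- Z) \<inter> U = {}" by (auto simp: Z_def)
  moreover have "V \<subseteq> Z" unfolding Z_def by (rule interior_maximal) (use V in auto)
  ultimately have "U \<subseteq> Z" using cover V by auto
  then show ?thesis using z interior_subset by (auto simp: Z_def)
qed

lemma axis_analytic_on_cong:
  assumes f: "axis_analytic_on f U" and U: "open U" and eq: "\<And>z. z \<in> U \<Longrightarrow> f z = g z"
  shows "axis_analytic_on g U"
  unfolding axis_analytic_on_def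
proof
  fix z assume z: "z \<in> U"
  then obtain r where r: "r > 0" "axis_analytic_at f z r"
    using f by (auto simp: axis_analytic_on_def)
  obtain \<delta> where \<delta>: "\<delta> > 0" "ball z \<delta> \<subseteq> U"
    using U z by (auto simp: open_contains_ball)
  define \<rho> where "\<rho> = min r (\<delta> / 2)"
  have \<rho>: "\<rho> > 0" "\<rho> \<le> \<delta> / 2" and at: "axis_analytic_at f z \<rho>"
    using r \<delta> by (auto simp: \<rho>_def min_def intro: axis_analytic_at_mono)
  have fg: "f (z + Complex x y) = g (z + Complex x y)" if "\<bar>x\<bar> < \<rho>" "\<bar>y\<bar> < \<rho>" for x y
  proof -
    have "cmod (Complex x y) < \<delta>"
      using cmod_le[of "Complex x y"] that \<rho> by simp
    then have "z + Complex x y \<in> ball z \<delta>" by (simp add: dist_norm)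
    then show ?thesis using \<delta> eq by blast
  qed
  have "axis_analytic_at g z \<rho>"
    using at fg unfolding axis_analytic_at_def by fastforce
  with \<rho> show "\<exists>\<rho>>0. axis_analytic_at g z \<rho>" by blast
qed

section \<open>Convergence of the expansions of correlation functions\<close>

lemma expands_at_0_has_sum:
  assumes "expands_at_0 g A"
  obtains R where "R > 0" "\<And>p. 0 < norm p \<Longrightarrow> norm p < R \<Longrightarrow>
    ((\<lambda>(r, s). A r s * zpow r s p) has_sum g p) UNIV"
proof -
  obtain R where R: "R > 0" and unif: "\<And>K. compact K \<and> K \<subseteq> ball 0 R - {0} \<Longrightarrow>
      uniform_limit K (\<lambda>S p. \<Sum>(r, s)\<in>S. A r s * zpow r s p) g (finite_subsets_at_top UNIV)"
    using assms unfolding expands_at_0_def by blast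
  have "((\<lambda>(r, s). A r s * zpow r s p) has_sum g p) UNIV" if "0 < norm p" "norm p < R" for p
    unfolding has_sum_def
    by (rule tendsto_uniform_limitI[OF unif[of "{p}"]]) (use that in auto)
  with R show ?thesis by (rule that)
qed

lemma expands_at_0_unique:
  assumes "expands_at_0 g A" "expands_at_0 g B"
  shows "A = B"
proof -
  obtain R where R: "R > 0" "\<And>p. 0 < norm p \<Longrightarrow> norm p < R \<Longrightarrow>
    ((\<lambda>(r, s). A r s * zpow r s p) has_sum g p) UNIV"
    using expands_at_0_has_sum[OF assms(1)] by blast
  obtain R' where R': "R' > 0" "\<And>p. 0 < norm p \<Longrightarrow> norm p < R' \<Longrightarrow>
    ((\<lambda>(r, s). B r s * zpow r s p) has_sum g p) UNIV"
    using expands_at_0_has_sum[OF assms(2)] by blast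
  show ?thesis
    by (rule formal_series_bdd_eqI[where R = "min R R'" and g = g])
       (use assms R R' in \<open>auto simp: expands_at_0_def\<close>)
qed

lemma expands_at_0_the: "expands_at_0 g A \<Longrightarrow> expands_at_0 g (THE A. expands_at_0 g A)"
  using expands_at_0_unique by (metis the_equality)

lemma expands_at_0_cong:
  assumes "expands_at_0 g A" "\<delta> > 0" and eq: "\<And>p. norm p < \<delta> \<Longrightarrow> g p = g' p"
  shows "expands_at_0 g' A"
proof -
  obtain R where R: "R > 0" and sm: "\<And>p. p \<in> ball 0 R - {0} \<Longrightarrow> (\<lambda>(r, s). norm (A r s * zpow r s p)) summable_on UNIV"
    and unif: "\<And>K. compact K \<and> K \<subseteq> ball 0 R - {0} \<Longrightarrow>
      uniform_limit K (\<lambda>S p. \<Sum>(r, s)\<in>S. A r s * zpow r s p) g (finite_subsets_at_top UNIV)"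
    and A: "A \<in> formal_series_bdd"
    using assms(1) unfolding expands_at_0_def by blast
  have "uniform_limit K (\<lambda>S p. \<Sum>(r, s)\<in>S. A r s * zpow r s p) g' (finite_subsets_at_top UNIV)"
    if K: "compact K" "K \<subseteq> ball 0 (min R \<delta>) - {0}" for K
  proof -
    have "uniform_limit K (\<lambda>S p. \<Sum>(r, s)\<in>S. A r s * zpow r s p) g (finite_subsets_at_top UNIV)"
      using K by (intro unif) auto
    moreover have "g p = g' p" if "p \<in> K" for p
      using that K by (intro eq) auto
    ultimately show ?thesis
      by (subst uniform_limit_cong'[where g = "\<lambda>S p. \<Sum>(r, s)\<in>S. A r s * zpow r s p" and i = g]) auto
  qed
  then show ?thesis
    unfolding expands_at_0_def using A R assms(2) sm
    by (intro conjI exI[of _ "min R \<delta>"]) auto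
qed

lemma expands_j_inf:
  assumes "f \<in> F01inf"
  shows "expands_at_0 (\<lambda>p. f (1 / p)) (j_inf f)"
proof -
  have "holomorphic_chart 0 (\<lambda>x. x) UNIV"
    by (simp add: holomorphic_chart_def)
  then obtain A where "expands_at_0 (\<lambda>p. f (1 / inv_into UNIV (\<lambda>x. x) p)) A"
    using assms unfolding F01inf_def conformal_singularity_def by blast
  then have "expands_at_0 (\<lambda>p. f (1 / p)) A"
    by (simp add: inv_into_f_f[of "\<lambda>x. x"])
  then show ?thesis
    unfolding j_inf_def by (rule expands_at_0_the)
qed

lemma expands_j_one:
  assumes "f \<in> F01inf"
  shows "expands_at_0 (\<lambda>p. f (1 / (1 - p))) (j_one f)"
proof -
  define \<phi> where "\<phi> p = 1 - 1 / p" for p :: complex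
  have inj: "inj_on \<phi> (- {0})"
    by (rule inj_onI) (auto simp: \<phi>_def field_simps)
  have "holomorphic_chart 1 \<phi> (- {0})"
    using inj unfolding holomorphic_chart_def
    by (auto simp: \<phi>_def[abs_def] intro!: holomorphic_intros)
  then obtain A where A: "expands_at_0 (\<lambda>p. f (inv_into (- {0}) \<phi> p)) A"
    using assms unfolding F01inf_def conformal_singularity_def by blast
  have "inv_into (- {0}) \<phi> p = 1 / (1 - p)" if "norm p < 1" for p
    using that by (intro inv_into_f_eq[OF inj]) (auto simp: \<phi>_def)
  then have "expands_at_0 (\<lambda>p. f (1 / (1 - p))) A"
    by (intro expands_at_0_cong[OF A, of 1]) auto
  then show ?thesis
    unfolding j_one_def by (rule expands_at_0_the)
qed

lemma finite_bounded_below_support: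
  fixes A :: "real \<Rightarrow> real \<Rightarrow> 'v::zero"
  assumes "\<And>r s. A r s \<noteq> 0 \<Longrightarrow> r \<ge> N \<and> s \<ge> N"
  shows "finite {(i::nat, j::nat). A (r - real i) (s - real j) \<noteq> 0}"
proof (rule finite_subset)
  show "{(i::nat, j::nat). A (r - real i) (s - real j) \<noteq> 0} \<subseteq> {..nat \<lfloor>r - N\<rfloor>} \<times> {..nat \<lfloor>s - N\<rfloor>}"
    using assms by (force intro!: le_nat_floor)
qed simp

lemma binomial_mult_has_sum:
  assumes A: "A \<in> formal_series_bdd" and \<alpha>\<beta>: "\<alpha> - \<beta> \<in> \<int>" and p: "p \<noteq> 0" "norm p < 1"
    and sum: "((\<lambda>(r, s). A r s * zpow r s p) has_sum v) UNIV"
  shows "((\<lambda>(r, s). binomial_mult \<alpha> \<beta> A r s * zpow r s p) has_sum zpow \<alpha> \<beta> (1 - p) * v) UNIV"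
proof -
  obtain N where N: "\<And>r s. A r s \<noteq> 0 \<Longrightarrow> r \<ge> N \<and> s \<ge> N"
    and int: "\<And>r s. A r s \<noteq> 0 \<Longrightarrow> r - s \<in> \<int>"
    using A by (auto simp: formal_series_bdd_def formal_series_def)
  define c :: "nat \<Rightarrow> nat \<Rightarrow> complex" where
    "c i j = of_real ((\<alpha> gchoose i) * (-1) ^ i) * of_real ((\<beta> gchoose j) * (-1) ^ j)" for i j
  define h where "h = (\<lambda>((r, s), (i, j)). c i j * A (r - real i) (s - real j) * zpow r s p)"
  have h_shift: "h ((r + real i, s + real j), (i, j)) = c i j * (p ^ i * cnj p ^ j) * (A r s * zpow r s p)"
    for i j r s
  proof (cases "A r s = 0")
    case False
    then show ?thesis
      using zpow_add[OF p(1) int[OF False], of "real i" "real j"] zpow_of_nat[OF p(1), of i j]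
      by (simp add: h_def mult_ac)
  qed (simp add: h_def)
  have "((\<lambda>(x, y). (case x of (i, j) \<Rightarrow> c i j * (p ^ i * cnj p ^ j)) * (case y of (r, s) \<Rightarrow> A r s * zpow r s p))
      has_sum zpow \<alpha> \<beta> (1 - p) * v) (UNIV \<times> UNIV)"
    unfolding c_def by (intro has_sum_times zpow_binomial sum p \<alpha>\<beta>)
  also have "?this \<longleftrightarrow> (h has_sum zpow \<alpha> \<beta> (1 - p) * v) (UNIV \<times> UNIV)"
    by (rule has_sum_reindex_bij_witness[where
        i = "\<lambda>((r, s), (i, j)). ((i, j), (r - real i, s - real j))" and
        j = "\<lambda>((i, j), (r, s)). ((r + real i, s + real j), (i, j))"])
       (auto simp: h_shift split: prod.splits)
  finally have hs: "(h has_sum zpow \<alpha> \<beta> (1 - p) * v) (UNIV \<times> UNIV)" .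
  show ?thesis
  proof (rule has_sum_SigmaD[OF hs])
    fix x :: "real \<times> real"
    obtain r s where x: "x = (r, s)" by (cases x)
    let ?B = "{(i::nat, j::nat). A (r - real i) (s - real j) \<noteq> 0}"
    have "(case (i, j) of (i, j) \<Rightarrow> c i j * A (r - real i) (s - real j)) * zpow r s p = h (x, (i, j))" for i j
      by (simp add: h_def x)
    then have "binomial_mult \<alpha> \<beta> A r s * zpow r s p = (\<Sum>y\<in>?B. h (x, y))"
      unfolding binomial_mult_def c_def[symmetric] sum_distrib_right
      by (intro sum.cong) (auto simp: h_def x)
    then show "((\<lambda>y. h (x, y)) has_sum (case x of (r, s) \<Rightarrow> binomial_mult \<alpha> \<beta> A r s * zpow r s p)) UNIV"
      by (intro has_sum_finite_neutralI[OF finite_bounded_below_support[of A N r s, OF N]])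
         (auto simp: x h_def)
  qed
qed

lemma binomial_mult_nonzero_int:
  assumes "A \<in> formal_series_bdd" "binomial_mult \<alpha> \<beta> A r s \<noteq> 0"
  shows "r - s \<in> \<int>"
proof -
  obtain i j :: nat where "A (r - real i) (s - real j) \<noteq> 0"
  proof (rule ccontr)
    assume "\<not> thesis"
    then have "A (r - real i) (s - real j) = 0" for i j :: nat using that by blast
    then show False using assms(2) by (simp add: binomial_mult_def)
  qed
  then have "r - real i - (s - real j) \<in> \<int>"
    using assms(1) by (auto simp: formal_series_bdd_def formal_series_def)
  from Ints_add[OF this Ints_diff[OF Ints_of_nat Ints_of_nat, of i j]]
  show ?thesis by simp
qed

text \<open>
  Unconditional summation of a two-variable series at the point \<open>(x, y)\<close>; for complex terms this is
  absolute convergence.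
\<close>

definition series2_sum :: "formal_series2 \<Rightarrow> complex \<Rightarrow> complex \<Rightarrow> complex \<Rightarrow> bool" where
  "series2_sum E x y v \<longleftrightarrow>
     ((\<lambda>(r, s, r', s'). E r s r' s' * zpow r s x * zpow r' s' y) has_sum v) UNIV"

lemma series2_sum_line:
  assumes "\<And>r s r' s'. E r s r' s' \<noteq> 0 \<Longrightarrow> r + r' = H \<and> s + s' = H'"
  shows "series2_sum E x y v \<longleftrightarrow>
    ((\<lambda>(r, s). E r s (H - r) (H' - s) * zpow r s x * zpow (H - r) (H' - s) y) has_sum v) UNIV"
proof -
  let ?f = "\<lambda>(r, s, r', s'). E r s r' s' * zpow r s x * zpow r' s' y"
  let ?k = "\<lambda>(r, s). (r, s, H - r, H' - s)"
  have "series2_sum E x y v \<longleftrightarrow> (?f has_sum v) (range ?k)"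
    unfolding series2_sum_def
  proof (rule has_sum_cong_neutral)
    fix q assume q: "q \<in> UNIV - range ?k"
    obtain r s r' s' where [simp]: "q = (r, s, r', s')" by (metis surj_pair)
    have "\<not> (r + r' = H \<and> s + s' = H')"
    proof
      assume "r + r' = H \<and> s + s' = H'"
      then have "q = ?k (r, s)" by auto
      then show False using q by blast
    qed
    then show "?f q = 0" using assms by auto
  qed auto
  also have "\<dots> \<longleftrightarrow> (?f \<circ> ?k has_sum v) UNIV"
    by (rule has_sum_reindex) (auto simp: inj_on_def)
  finally show ?thesis by (simp add: o_def case_prod_unfold)
qed

lemma ratio_series_sum:
  assumes S: "\<And>r s. S r s \<noteq> 0 \<Longrightarrow> r - s \<in> \<int>" and ab: "a - b \<in> \<int>" "a' - b' \<in> \<int>"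
    and xy: "x \<noteq> 0" "y \<noteq> 0"
    and sum: "((\<lambda>(r, s). S r s * zpow r s (x / y)) has_sum v) UNIV"
  shows "series2_sum (ratio_series a b a' b' S) x y (zpow a b x * zpow a' b' y * v)"
proof -
  let ?H = "a + a'" and ?H' = "b + b'"
  have "series2_sum (ratio_series a b a' b' S) x y (zpow a b x * zpow a' b' y * v) \<longleftrightarrow>
    ((\<lambda>(r, s). S (r - a) (s - b) * zpow r s x * zpow (?H - r) (?H' - s) y)
       has_sum zpow a b x * zpow a' b' y * v) UNIV"
    by (subst series2_sum_line[of _ ?H ?H'])
       (auto simp: ratio_series_def case_prod_unfold split: if_splits)
  also have "\<dots> \<longleftrightarrow> ((\<lambda>i. zpow a b x * zpow a' b' y * (case i of (r, s) \<Rightarrow> S r s * zpow r s (x / y)))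
       has_sum zpow a b x * zpow a' b' y * v) UNIV"
  proof (rule has_sum_reindex_bij_witness[where j = "\<lambda>(r, s). (r - a, s - b)" and i = "\<lambda>(r, s). (r + a, s + b)"])
    fix q :: "real \<times> real"
    obtain r s where q: "q = (r + a, s + b)"
      by (cases q) (metis diff_add_cancel)
    show "zpow a b x * zpow a' b' y * (case case q of (r, s) \<Rightarrow> (r - a, s - b) of (r, s) \<Rightarrow> S r s * zpow r s (x / y)) =
         (case q of (r, s) \<Rightarrow> S (r - a) (s - b) * zpow r s x * zpow (?H - r) (?H' - s) y)"
    proof (cases "S r s = 0")
      case False
      note int = S[OF False]
      have "zpow (r + a) (s + b) x = zpow r s x * zpow a b x"
        by (rule zpow_add[OF xy(1) int ab(1)])
      moreover have "zpow (a' + - r) (b' + - s) y = zpow a' b' y * zpow (- r) (- s) y"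
        using Ints_minus[OF int] by (intro zpow_add[OF xy(2) ab(2)]) simp
      moreover have "zpow r s (x / y) = zpow r s x * zpow (- r) (- s) y"
        by (rule zpow_divide[OF xy(2) int])
      ultimately show ?thesis by (simp add: q)
    qed (simp add: q)
  qed (auto split: prod.splits)
  finally show ?thesis using has_sum_cmult_right[OF sum] by blast
qed

lemma zpow_minus_powi: "zpow r s (- z) = (- 1) powi \<lfloor>r - s\<rfloor> * zpow r s z"
  by (simp add: zpow_minus power_int_minus_left)

text \<open>
  On generators the formal expansions converge to the function: this one near \<open>z\<^sub>1/z\<^sub>2 = 0\<close>, the
  other one (\<open>gcor_exp_02_sum\<close>) near \<open>(z\<^sub>1 - z\<^sub>2)/z\<^sub>2 = 0\<close>.
\<close>

lemma gcor_exp_21_sum: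
  assumes d: "gcor_data_ok d"
  shows "\<exists>\<epsilon>>0. \<forall>x y. 0 < norm x \<and> norm x < \<epsilon> * norm y \<longrightarrow>
    series2_sum (gcor_exp_21 d) x y (gcor_fun d (x, y))"
proof -
  have int: "\<alpha>\<^sub>1 d - \<beta>\<^sub>1 d \<in> \<int>" "\<alpha>\<^sub>2 d - \<beta>\<^sub>2 d \<in> \<int>" "\<alpha>\<^sub>1\<^sub>2 d - \<beta>\<^sub>1\<^sub>2 d \<in> \<int>" and f: "cross d \<in> F01inf"
    using d by (auto simp: gcor_data_ok_def)
  have int': "\<alpha>\<^sub>2 d + \<alpha>\<^sub>1\<^sub>2 d - (\<beta>\<^sub>2 d + \<beta>\<^sub>1\<^sub>2 d) \<in> \<int>"
    using Ints_add[OF int(2,3)] by (simp add: algebra_simps)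
  define J where "J = j_inf (cross d)"
  have J: "expands_at_0 (\<lambda>p. cross d (1 / p)) J"
    unfolding J_def by (rule expands_j_inf[OF f])
  then have J_bdd: "J \<in> formal_series_bdd" by (simp add: expands_at_0_def)
  obtain R where R: "R > 0" "\<And>p. 0 < norm p \<Longrightarrow> norm p < R \<Longrightarrow>
      ((\<lambda>(r, s). J r s * zpow r s p) has_sum cross d (1 / p)) UNIV"
    using expands_at_0_has_sum[OF J] by blast
  have "series2_sum (gcor_exp_21 d) x y (gcor_fun d (x, y))"
    if xy: "0 < norm x" "norm x < min R 1 * norm y" for x y
  proof -
    have nz: "x \<noteq> 0" "y \<noteq> 0" using xy by auto
    define p where "p = x / y"
    have p: "p \<noteq> 0" "norm p < 1" "norm p < R"
      using nz less_le_trans[OF xy(2) mult_right_mono[OF min.cobounded1 norm_ge_zero]]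
        less_le_trans[OF xy(2) mult_right_mono[OF min.cobounded2 norm_ge_zero]]
      by (auto simp: p_def norm_divide pos_divide_less_eq)
    have "x \<noteq> y" using p(2) nz by (auto simp: p_def)
    let ?S = "binomial_mult (\<alpha>\<^sub>1\<^sub>2 d) (\<beta>\<^sub>1\<^sub>2 d) J"
    have "((\<lambda>(r, s). ?S r s * zpow r s (x / y)) has_sum
        zpow (\<alpha>\<^sub>1\<^sub>2 d) (\<beta>\<^sub>1\<^sub>2 d) (1 - p) * cross d (1 / p)) UNIV"
      using binomial_mult_has_sum[OF J_bdd int(3) p(1,2) R(2)] p by (simp add: p_def)
    then have "series2_sum (ratio_series (\<alpha>\<^sub>1 d) (\<beta>\<^sub>1 d) (\<alpha>\<^sub>2 d + \<alpha>\<^sub>1\<^sub>2 d) (\<beta>\<^sub>2 d + \<beta>\<^sub>1\<^sub>2 d) ?S) x y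
        (zpow (\<alpha>\<^sub>1 d) (\<beta>\<^sub>1 d) x * zpow (\<alpha>\<^sub>2 d + \<alpha>\<^sub>1\<^sub>2 d) (\<beta>\<^sub>2 d + \<beta>\<^sub>1\<^sub>2 d) y *
          (zpow (\<alpha>\<^sub>1\<^sub>2 d) (\<beta>\<^sub>1\<^sub>2 d) (1 - p) * cross d (1 / p)))"
      by (intro ratio_series_sum binomial_mult_nonzero_int[OF J_bdd] int int' nz)
    then have "series2_sum (gcor_exp_21 d) x y ((- 1) powi \<lfloor>\<alpha>\<^sub>1\<^sub>2 d - \<beta>\<^sub>1\<^sub>2 d\<rfloor> *
        (zpow (\<alpha>\<^sub>1 d) (\<beta>\<^sub>1 d) x * zpow (\<alpha>\<^sub>2 d + \<alpha>\<^sub>1\<^sub>2 d) (\<beta>\<^sub>2 d + \<beta>\<^sub>1\<^sub>2 d) y *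
          (zpow (\<alpha>\<^sub>1\<^sub>2 d) (\<beta>\<^sub>1\<^sub>2 d) (1 - p) * cross d (1 / p))))"
      unfolding series2_sum_def gcor_exp_21_def J_def
      by (drule_tac has_sum_cmult_right) (simp add: case_prod_unfold mult.assoc)
    moreover have "x - y = - (y * (1 - p))" using nz by (simp add: p_def algebra_simps)
    then have "zpow (\<alpha>\<^sub>1\<^sub>2 d) (\<beta>\<^sub>1\<^sub>2 d) (x - y) = (- 1) powi \<lfloor>\<alpha>\<^sub>1\<^sub>2 d - \<beta>\<^sub>1\<^sub>2 d\<rfloor> *
        (zpow (\<alpha>\<^sub>1\<^sub>2 d) (\<beta>\<^sub>1\<^sub>2 d) y * zpow (\<alpha>\<^sub>1\<^sub>2 d) (\<beta>\<^sub>1\<^sub>2 d) (1 - p))"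
      by (simp only: zpow_minus_powi zpow_mult)
    ultimately show ?thesis
      using nz \<open>x \<noteq> y\<close> zpow_add[OF nz(2) int(2,3)]
      by (simp add: gcor_fun_def Y2_def p_def mult_ac)
  qed
  then show ?thesis using R(1) by (intro exI[of _ "min R 1"]) auto
qed

lemma gcor_exp_02_sum:
  assumes d: "gcor_data_ok d"
  shows "\<exists>\<epsilon>>0. \<forall>x y. 0 < norm x \<and> norm x < \<epsilon> * norm y \<longrightarrow>
    series2_sum (gcor_exp_02 d) x y (gcor_fun d (y + x, y))"
proof -
  have int: "\<alpha>\<^sub>1 d - \<beta>\<^sub>1 d \<in> \<int>" "\<alpha>\<^sub>2 d - \<beta>\<^sub>2 d \<in> \<int>" "\<alpha>\<^sub>1\<^sub>2 d - \<beta>\<^sub>1\<^sub>2 d \<in> \<int>" and f: "cross d \<in> F01inf"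
    using d by (auto simp: gcor_data_ok_def)
  have int': "\<alpha>\<^sub>1 d + \<alpha>\<^sub>2 d - (\<beta>\<^sub>1 d + \<beta>\<^sub>2 d) \<in> \<int>"
    using Ints_add[OF int(1,2)] by (simp add: algebra_simps)
  define J where "J = j_one (cross d)"
  have J: "expands_at_0 (\<lambda>p. cross d (1 / (1 - p))) J"
    unfolding J_def by (rule expands_j_one[OF f])
  then have J_bdd: "J \<in> formal_series_bdd" by (simp add: expands_at_0_def)
  obtain R where R: "R > 0" "\<And>p. 0 < norm p \<Longrightarrow> norm p < R \<Longrightarrow>
      ((\<lambda>(r, s). J r s * zpow r s p) has_sum cross d (1 / (1 - p))) UNIV"
    using expands_at_0_has_sum[OF J] by blast
  have "series2_sum (gcor_exp_02 d) x y (gcor_fun d (y + x, y))"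
    if xy: "0 < norm x" "norm x < min R 1 * norm y" for x y
  proof -
    have nz: "x \<noteq> 0" "y \<noteq> 0" using xy by auto
    define p where "p = - (x / y)"
    have p: "p \<noteq> 0" "norm p < 1" "norm p < R"
      using nz less_le_trans[OF xy(2) mult_right_mono[OF min.cobounded1 norm_ge_zero]]
        less_le_trans[OF xy(2) mult_right_mono[OF min.cobounded2 norm_ge_zero]]
      by (auto simp: p_def norm_divide pos_divide_less_eq)
    have yx: "y + x = y * (1 - p)" using nz by (simp add: p_def algebra_simps)
    have "1 - p \<noteq> 0" using p(2) by auto
    then have "y + x \<noteq> 0" using nz yx by simp
    let ?S = "formal_neg (binomial_mult (\<alpha>\<^sub>1 d) (\<beta>\<^sub>1 d) J)"
    have "?S r s * zpow r s (x / y) = binomial_mult (\<alpha>\<^sub>1 d) (\<beta>\<^sub>1 d) J r s * zpow r s p" for r s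
      by (simp add: formal_neg_def p_def zpow_minus)
    then have "((\<lambda>(r, s). ?S r s * zpow r s (x / y)) has_sum
        zpow (\<alpha>\<^sub>1 d) (\<beta>\<^sub>1 d) (1 - p) * cross d (1 / (1 - p))) UNIV"
      using binomial_mult_has_sum[OF J_bdd int(1) p(1,2) R(2)] p by simp
    then have "series2_sum (gcor_exp_02 d) x y
        (zpow (\<alpha>\<^sub>1\<^sub>2 d) (\<beta>\<^sub>1\<^sub>2 d) x * zpow (\<alpha>\<^sub>1 d + \<alpha>\<^sub>2 d) (\<beta>\<^sub>1 d + \<beta>\<^sub>2 d) y *
          (zpow (\<alpha>\<^sub>1 d) (\<beta>\<^sub>1 d) (1 - p) * cross d (1 / (1 - p))))"
      unfolding gcor_exp_02_def J_def[symmetric]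
      using binomial_mult_nonzero_int[OF J_bdd]
      by (intro ratio_series_sum int int' nz) (auto simp: formal_neg_def split: if_splits)
    moreover have "zpow (\<alpha>\<^sub>1 d) (\<beta>\<^sub>1 d) (y + x) = zpow (\<alpha>\<^sub>1 d) (\<beta>\<^sub>1 d) y * zpow (\<alpha>\<^sub>1 d) (\<beta>\<^sub>1 d) (1 - p)"
      by (simp only: yx zpow_mult)
    moreover have "1 / (1 - p) = y / (y + x)" using nz by (simp add: yx)
    ultimately show ?thesis
      using nz \<open>y + x \<noteq> 0\<close> zpow_add[OF nz(2) int(1,2)]
      by (simp add: gcor_fun_def Y2_def mult_ac)
  qed
  then show ?thesis using R(1) by (intro exI[of _ "min R 1"]) auto
qed

text \<open>
  Convergence extends to the linear span. In particular the expansion of \<open>\<mu>\<close> sums to \<open>\<mu>\<close>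
  whichever representation by generators was used.
\<close>

lemma gcor_expands_sum:
  fixes pt :: "complex \<Rightarrow> complex \<Rightarrow> complex \<times> complex"
  assumes E: "gcor_expands X \<mu> E"
    and gen: "\<And>d. gcor_data_ok d \<Longrightarrow> \<exists>\<epsilon>>0. \<forall>x y. 0 < norm x \<and> norm x < \<epsilon> * norm y \<longrightarrow>
      series2_sum (X d) x y (gcor_fun d (pt x y))"
  shows "\<exists>\<epsilon>>0. \<forall>x y. 0 < norm x \<and> norm x < \<epsilon> * norm y \<longrightarrow> series2_sum E x y (\<mu> (pt x y))"
proof -
  let ?P = "\<lambda>(\<mu> :: complex \<times> complex \<Rightarrow> complex, E). \<exists>\<epsilon>>0. \<forall>x y. 0 < norm x \<and> norm x < \<epsilon> * norm y \<longrightarrow>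
      series2_sum E x y (\<mu> (pt x y))"
  have "?P (\<mu>, E)"
  proof (rule module.span_induct[OF module_gcor_graph E[unfolded gcor_expands_def]])
    show "module.subspace (\<lambda>c (\<mu> :: complex \<times> complex \<Rightarrow> complex, E :: formal_series2).
        (\<lambda>z. c * \<mu> z, \<lambda>r s r' s'. c * E r s r' s')) (Collect ?P)"
    proof (rule module.subspaceI[OF module_gcor_graph])
      show "0 \<in> Collect ?P"
        by (auto simp: zero_prod_def series2_sum_def zero_fun_def case_prod_unfold intro!: exI[of _ 1])
    next
      fix S T assume ST: "S \<in> Collect ?P" "T \<in> Collect ?P"
      obtain \<mu> E \<mu>' E' where [simp]: "S = (\<mu>, E)" "T = (\<mu>', E')" by (cases S, cases T)
      obtain \<epsilon> \<epsilon>' where \<epsilon>: "\<epsilon> > 0" "\<epsilon>' > 0"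
        "\<And>x y. 0 < norm x \<Longrightarrow> norm x < \<epsilon> * norm y \<Longrightarrow> series2_sum E x y (\<mu> (pt x y))"
        "\<And>x y. 0 < norm x \<Longrightarrow> norm x < \<epsilon>' * norm y \<Longrightarrow> series2_sum E' x y (\<mu>' (pt x y))"
        using ST by auto
      have "series2_sum (E + E') x y ((\<mu> + \<mu>') (pt x y))"
        if "0 < norm x" "norm x < min \<epsilon> \<epsilon>' * norm y" for x y
      proof -
        have "norm x < \<epsilon> * norm y" "norm x < \<epsilon>' * norm y"
          using less_le_trans[OF that(2) mult_right_mono[OF min.cobounded1 norm_ge_zero]]
            less_le_trans[OF that(2) mult_right_mono[OF min.cobounded2 norm_ge_zero]] by auto
        then have "series2_sum E x y (\<mu> (pt x y))" "series2_sum E' x y (\<mu>' (pt x y))"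
          using \<epsilon>(3,4) that(1) by blast+
        from has_sum_add[OF this[unfolded series2_sum_def]] show ?thesis
          by (simp add: series2_sum_def case_prod_unfold algebra_simps)
      qed
      then show "S + T \<in> Collect ?P"
        using \<epsilon>(1,2) by (auto simp: plus_prod_def intro!: exI[of _ "min \<epsilon> \<epsilon>'"])
    next
      fix c :: complex and S assume S: "S \<in> Collect ?P"
      obtain \<mu> E where [simp]: "S = (\<mu>, E)" by (cases S)
      obtain \<epsilon> where \<epsilon>: "\<epsilon> > 0"
        "\<And>x y. 0 < norm x \<Longrightarrow> norm x < \<epsilon> * norm y \<Longrightarrow> series2_sum E x y (\<mu> (pt x y))"
        using S by auto
      have "series2_sum (\<lambda>r s r' s'. c * E r s r' s') x y (c * \<mu> (pt x y))"
        if "0 < norm x" "norm x < \<epsilon> * norm y" for x y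
        using has_sum_cmult_right[OF \<epsilon>(2)[OF that, unfolded series2_sum_def], of c]
        by (simp add: series2_sum_def case_prod_unfold mult.assoc)
      then show "(case S of (\<mu>, E) \<Rightarrow> (\<lambda>z. c * \<mu> z, \<lambda>r s r' s'. c * E r s r' s')) \<in> Collect ?P"
        using \<epsilon>(1) by auto
    qed
  qed (use gen in auto)
  then show ?thesis by simp
qed

text \<open>
  For fixed \<open>z\<^sub>1 = w\<close> the generators are products of axis-analytic functions of
  \<open>p = z\<^sub>2/z\<^sub>1\<close>.
\<close>

lemma GCor2_axis_analytic:
  assumes "\<mu> \<in> GCor2" "w \<noteq> 0"
  shows "axis_analytic_on (\<lambda>p. \<mu> (w, w * p)) (- {0, 1})"
proof (rule module.span_induct[OF module_GCor2 assms(1)[unfolded GCor2_def]])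
  show "module.subspace (\<lambda>c \<mu> z. c * \<mu> z) {\<mu>. axis_analytic_on (\<lambda>p. \<mu> (w, w * p)) (- {0, 1})}"
    by (rule module.subspaceI[OF module_GCor2])
       (auto simp: zero_fun_def plus_fun_def
          intro: axis_analytic_on_const axis_analytic_on_add axis_analytic_on_mult)
next
  fix \<mu> assume "\<mu> \<in> gcor_fun ` {d. gcor_data_ok d}"
  then obtain d where d: "gcor_data_ok d" and \<mu>: "\<mu> = gcor_fun d" by auto
  have int: "\<alpha>\<^sub>1 d - \<beta>\<^sub>1 d \<in> \<int>" "\<alpha>\<^sub>2 d - \<beta>\<^sub>2 d \<in> \<int>" "\<alpha>\<^sub>1\<^sub>2 d - \<beta>\<^sub>1\<^sub>2 d \<in> \<int>" and f: "cross d \<in> F01inf"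
    using d by (auto simp: gcor_data_ok_def)
  have "axis_analytic_on (\<lambda>p. zpow (\<alpha>\<^sub>1 d) (\<beta>\<^sub>1 d) w * (zpow (\<alpha>\<^sub>2 d) (\<beta>\<^sub>2 d) w * zpow (\<alpha>\<^sub>2 d) (\<beta>\<^sub>2 d) (p - 0)) *
      (zpow (\<alpha>\<^sub>1\<^sub>2 d) (\<beta>\<^sub>1\<^sub>2 d) (- w) * zpow (\<alpha>\<^sub>1\<^sub>2 d) (\<beta>\<^sub>1\<^sub>2 d) (p - 1)) * cross d p) (- {0, 1})"
    using f by (intro axis_analytic_on_mult axis_analytic_on_const real_analytic_on_imp_axis_analytic_on
        axis_analytic_on_subset[OF axis_analytic_on_zpow] int) (auto simp: F01inf_def)
  then have "axis_analytic_on (\<lambda>p. \<mu> (w, w * p)) (- {0, 1})"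
  proof (rule axis_analytic_on_cong)
    fix p :: complex assume p: "p \<in> - {0, 1}"
    have "w - w * p = - w * (p - 1)" by (simp add: algebra_simps)
    then have "zpow (\<alpha>\<^sub>1\<^sub>2 d) (\<beta>\<^sub>1\<^sub>2 d) (w - w * p) =
        zpow (\<alpha>\<^sub>1\<^sub>2 d) (\<beta>\<^sub>1\<^sub>2 d) (- w) * zpow (\<alpha>\<^sub>1\<^sub>2 d) (\<beta>\<^sub>1\<^sub>2 d) (p - 1)"
      by (simp only: zpow_mult)
    then show "zpow (\<alpha>\<^sub>1 d) (\<beta>\<^sub>1 d) w * (zpow (\<alpha>\<^sub>2 d) (\<beta>\<^sub>2 d) w * zpow (\<alpha>\<^sub>2 d) (\<beta>\<^sub>2 d) (p - 0)) *
      (zpow (\<alpha>\<^sub>1\<^sub>2 d) (\<beta>\<^sub>1\<^sub>2 d) (- w) * zpow (\<alpha>\<^sub>1\<^sub>2 d) (\<beta>\<^sub>1\<^sub>2 d) (p - 1)) * cross d p = \<mu> (w, w * p)"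
      using p assms(2) by (auto simp: \<mu> gcor_fun_def Y2_def zpow_mult)
  qed auto
  then show "axis_analytic_on (\<lambda>p. \<mu> (w, w * p)) (- {0, 1})" .
qed

section \<open>Comparing two expansions of one correlation function\<close>

lemma GCor2_eqI:
  assumes \<mu>: "\<mu> \<in> GCor2"
    and g: "\<And>w. w \<noteq> 0 \<Longrightarrow> axis_analytic_on (\<lambda>p. g (w, w * p)) (- {0, 1})"
    and V: "open V" "V \<noteq> {}" "V \<subseteq> - {0, 1}"
    and eq: "\<And>w p. w \<noteq> 0 \<Longrightarrow> p \<in> V \<Longrightarrow> \<mu> (w, w * p) = g (w, w * p)"
    and z: "(z1, z2) \<in> Y2"
  shows "\<mu> (z1, z2) = g (z1, z2)"
proof -
  have z': "z1 \<noteq> 0" "z2 \<noteq> 0" "z1 \<noteq> z2" using z by (auto simp: Y2_def)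
  have "connected (- {0, 1 :: complex})"
    using connected_UNIV connected_open_diff_countable[of UNIV "{0, 1 :: complex}"] by (simp add: Compl_eq_Diff_UNIV)
  moreover have "axis_analytic_on (\<lambda>p. \<mu> (z1, z1 * p) - g (z1, z1 * p)) (- {0, 1})"
    by (intro axis_analytic_on_diff GCor2_axis_analytic \<mu> g z')
  moreover have "\<mu> (z1, z1 * p) - g (z1, z1 * p) = 0" if "p \<in> V" for p
    using eq[OF z'(1) that] by simp
  moreover have "open (- {0, 1 :: complex})" by auto
  moreover have "z2 / z1 \<in> - {0, 1}" using z' by simp
  ultimately have "\<mu> (z1, z1 * (z2 / z1)) - g (z1, z1 * (z2 / z1)) = 0"
    using V axis_analytic_identity[where f = "\<lambda>p. \<mu> (z1, z1 * p) - g (z1, z1 * p)"] by blast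
  then show ?thesis using z' by simp
qed

lemma GCor2_eqI_21:
  assumes \<mu>: "\<mu> \<in> GCor2"
    and g: "\<And>w. w \<noteq> 0 \<Longrightarrow> axis_analytic_on (\<lambda>p. g (w, w * p)) (- {0, 1})"
    and "\<epsilon> > 0"
    and eq: "\<And>x y. 0 < norm x \<Longrightarrow> norm x < \<epsilon> * norm y \<Longrightarrow> \<mu> (x, y) = g (x, y)"
    and z: "(z1, z2) \<in> Y2"
  shows "\<mu> (z1, z2) = g (z1, z2)"
proof (rule GCor2_eqI[OF \<mu> g _ _ _ _ z])
  let ?V = "- {0, 1 :: complex} \<inter> {p. 1 < \<epsilon> * norm p}"
  show "?V \<subseteq> - {0, 1}" by (rule Int_lower1)
  show "open ?V"
    by (intro open_Int open_Collect_less continuous_intros)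
  show "?V \<noteq> {}"
  proof -
    define t where "t = 1 + 1 / \<epsilon>"
    have "\<epsilon> * t = \<epsilon> + 1" using \<open>\<epsilon> > 0\<close> by (simp add: t_def distrib_left)
    then have 1: "1 < \<epsilon> * t" using \<open>\<epsilon> > 0\<close> by linarith
    have t: "1 < t" using \<open>\<epsilon> > 0\<close> by (simp add: t_def)
    then have "norm (complex_of_real t) = t" by simp
    with 1 have "1 < \<epsilon> * norm (complex_of_real t)" by (simp only:)
    moreover have "complex_of_real t \<noteq> 0" "complex_of_real t \<noteq> 1"
      using t by (simp_all only: of_real_eq_0_iff of_real_eq_1_iff)
    ultimately have "complex_of_real t \<in> ?V" by blast
    then show ?thesis by blast
  qed
  show "\<mu> (w, w * p) = g (w, w * p)" if "w \<noteq> 0" "p \<in> ?V" for w p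
    using that by (intro eq) (auto simp: norm_mult)
qed

lemma GCor2_eqI_02:
  assumes \<mu>: "\<mu> \<in> GCor2"
    and g: "\<And>w. w \<noteq> 0 \<Longrightarrow> axis_analytic_on (\<lambda>p. g (w, w * p)) (- {0, 1})"
    and "\<epsilon> > 0"
    and eq: "\<And>x y. 0 < norm x \<Longrightarrow> norm x < \<epsilon> * norm y \<Longrightarrow> y + x \<noteq> 0 \<Longrightarrow> \<mu> (y + x, y) = g (y + x, y)"
    and z: "(z1, z2) \<in> Y2"
  shows "\<mu> (z1, z2) = g (z1, z2)"
proof (rule GCor2_eqI[OF \<mu> g _ _ _ _ z])
  let ?V = "- {0, 1 :: complex} \<inter> {p. norm (1 - p) < \<epsilon> * norm p}"
  show "?V \<subseteq> - {0, 1}" by (rule Int_lower1)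
  show "open ?V"
    by (intro open_Int open_Collect_less continuous_intros)
  show "?V \<noteq> {}"
  proof -
    define t where "t = 1 + \<epsilon>"
    have t: "1 < t" "t - 1 < \<epsilon> * t" using \<open>\<epsilon> > 0\<close> by (auto simp: t_def algebra_simps)
    have "1 - complex_of_real t = of_real (1 - t)" by simp
    then have "norm (1 - complex_of_real t) = t - 1" using t(1) by (simp only: norm_of_real)
    moreover have "norm (complex_of_real t) = t" using t(1) by simp
    ultimately have "norm (1 - complex_of_real t) < \<epsilon> * norm (complex_of_real t)"
      using t(2) by (simp only:)
    moreover have "complex_of_real t \<noteq> 0" "complex_of_real t \<noteq> 1"
      using t(1) by (simp_all only: of_real_eq_0_iff of_real_eq_1_iff)
    ultimately have "complex_of_real t \<in> ?V" by blast
    then show ?thesis by blast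
  qed
  show "\<mu> (w, w * p) = g (w, w * p)" if "w \<noteq> 0" "p \<in> ?V" for w p
  proof -
    have wp: "w * p + w * (1 - p) = w" by (simp add: algebra_simps)
    have "0 < norm (w * (1 - p))" "norm (w * (1 - p)) < \<epsilon> * norm (w * p)"
      using that by (simp_all add: norm_mult mult.left_commute)
    from eq[OF this] that(1) show ?thesis by (simp add: wp)
  qed
qed

lemma nat_support_formal_series_bdd:
  assumes "\<And>r s. A r s \<noteq> 0 \<Longrightarrow> r \<in> \<nat> \<and> s \<in> \<nat>"
  shows "A \<in> formal_series_bdd"
proof -
  have "{(r, s). A r s \<noteq> 0} \<subseteq> \<nat> \<times> \<nat>" using assms by auto
  then have "countable {(r, s). A r s \<noteq> 0}"
    by (rule countable_subset) (auto simp: Nats_def)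
  moreover have "r - s \<in> \<int>" "r \<ge> 0 \<and> s \<ge> 0" if "A r s \<noteq> 0" for r s
    using assms[OF that] Nats_subset_Ints by (auto intro!: Ints_diff simp: Nats_altdef2)
  ultimately show ?thesis unfolding formal_series_bdd_def formal_series_def by blast
qed

lemma nat_support_coeff_unique:
  assumes A: "\<And>r s. A r s \<noteq> 0 \<Longrightarrow> r \<in> \<nat> \<and> s \<in> \<nat>" and "R > 0"
    and sumA: "\<And>x. 0 < norm x \<Longrightarrow> norm x < R \<Longrightarrow> ((\<lambda>(r, s). A r s * zpow r s x) has_sum g x) UNIV"
    and sumc: "\<And>x. 0 < norm x \<Longrightarrow> norm x < R \<Longrightarrow> ((\<lambda>(i, j). c i j * (x ^ i * cnj x ^ j)) has_sum g x) UNIV"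
  shows "A (real i) (real j) = c i j"
proof -
  define B where "B r s = (if r \<in> \<nat> \<and> s \<in> \<nat> then c (nat \<lfloor>r\<rfloor>) (nat \<lfloor>s\<rfloor>) else 0)" for r s :: real
  have "A = B"
  proof (rule formal_series_bdd_eqI[OF _ _ \<open>R > 0\<close> sumA])
    show "A \<in> formal_series_bdd" by (rule nat_support_formal_series_bdd[OF A])
    show "B \<in> formal_series_bdd" by (rule nat_support_formal_series_bdd) (auto simp: B_def split: if_splits)
    fix x :: complex assume x: "0 < norm x" "norm x < R"
    let ?k = "\<lambda>(i, j). (real i, real j)"
    have "((\<lambda>(r, s). B r s * zpow r s x) \<circ> ?k has_sum g x) UNIV"
      using sumc[OF x] x by (simp add: o_def case_prod_unfold B_def zpow_of_nat)
    then have "((\<lambda>(r, s). B r s * zpow r s x) has_sum g x) (range ?k)"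
      by (subst has_sum_reindex) (auto simp: inj_on_def)
    then show "((\<lambda>(r, s). B r s * zpow r s x) has_sum g x) UNIV"
    proof (rule has_sum_cong_neutral[THEN iffD1, rotated -1])
      fix q assume q: "q \<in> UNIV - range ?k"
      have "B (fst q) (snd q) = 0"
      proof (rule ccontr)
        assume "B (fst q) (snd q) \<noteq> 0"
        then obtain i j where "q = ?k (i, j)"
          by (cases q) (auto simp: B_def Nats_def split: if_splits)
        then show False using q by blast
      qed
      then show "(case q of (r, s) \<Rightarrow> B r s * zpow r s x) = 0" by (simp add: case_prod_unfold)
    qed auto
  qed auto
  then show ?thesis by (simp add: B_def)
qed

text \<open>
  If the expansion in \<open>\<bar>z\<^sub>2\<bar> > \<bar>z\<^sub>1\<bar>\<close> is \<open>C z\<^sub>1\<^sup>H zbar\<^sub>1\<^sup>H\<^sup>'\<close>, then the one in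
  \<open>\<bar>z\<^sub>2\<bar> > \<bar>z\<^sub>1 - z\<^sub>2\<bar>\<close> is the binomial series of
  \<open>C (z\<^sub>2 + z\<^sub>0)\<^sup>H (zbar\<^sub>2 + zbar\<^sub>0)\<^sup>H\<^sup>'\<close>. By homogeneity it is enough to compare them at \<open>z\<^sub>2 = 1\<close>.
\<close>

lemma GCor2_power_expansion:
  assumes \<mu>: "\<mu> \<in> GCor2" and E02: "gcor_expands gcor_exp_02 \<mu> E02" and E21: "gcor_expands gcor_exp_21 \<mu> E21"
    and H: "H - H' \<in> \<int>"
    and E21_eq: "\<And>r s r' s'. E21 r s r' s' = (if r = H \<and> s = H' \<and> r' = 0 \<and> s' = 0 then C else 0)"
    and E02_supp: "\<And>r s r' s'. E02 r s r' s' \<noteq> 0 \<Longrightarrow> r + r' = H \<and> s + s' = H' \<and> r \<in> \<nat> \<and> s \<in> \<nat>"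
  shows "E02 (real i) (real j) (H - real i) (H' - real j) = of_real ((H gchoose i) * (H' gchoose j)) * C"
proof -
  obtain \<epsilon> where \<epsilon>: "\<epsilon> > 0" and sum21: "\<And>x y. 0 < norm x \<Longrightarrow> norm x < \<epsilon> * norm y \<Longrightarrow>
      series2_sum E21 x y (\<mu> (x, y))"
    using gcor_expands_sum[OF E21 gcor_exp_21_sum] by blast
  obtain \<delta> where \<delta>: "\<delta> > 0" and sum02: "\<And>x y. 0 < norm x \<Longrightarrow> norm x < \<delta> * norm y \<Longrightarrow>
      series2_sum E02 x y (\<mu> (y + x, y))"
    using gcor_expands_sum[OF E02 gcor_exp_02_sum] by blast
  have near: "\<mu> (x, y) = C * zpow H H' x" if xy: "0 < norm x" "norm x < \<epsilon> * norm y" for x y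
  proof (rule has_sum_unique)
    show "((\<lambda>(r, s, r', s'). E21 r s r' s' * zpow r s x * zpow r' s' y) has_sum \<mu> (x, y)) UNIV"
      using sum21[OF xy] by (simp add: series2_sum_def)
    have "y \<noteq> 0" using xy by auto
    then show "((\<lambda>(r, s, r', s'). E21 r s r' s' * zpow r s x * zpow r' s' y) has_sum C * zpow H H' x) UNIV"
      by (intro has_sum_finite_neutralI[of "{(H, H', 0, 0)}"]) (auto simp: E21_eq split: if_splits)
  qed
  have all: "\<mu> (z1, z2) = (\<lambda>(z1, z2). C * zpow H H' z1) (z1, z2)" if "(z1, z2) \<in> Y2" for z1 z2
    by (rule GCor2_eqI_21[OF \<mu> _ \<epsilon> _ that]) (auto simp: near intro: axis_analytic_on_const)
  show ?thesis
  proof (rule nat_support_coeff_unique[where A = "\<lambda>r s. E02 r s (H - r) (H' - s)" and R = "min \<delta> 1"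
        and g = "\<lambda>x. C * zpow H H' (1 + x)" and c = "\<lambda>i j. of_real ((H gchoose i) * (H' gchoose j)) * C"])
    fix x :: complex assume x: "0 < norm x" "norm x < min \<delta> 1"
    have "1 + x \<noteq> 0" using x by (auto simp: add_eq_0_iff)
    then have "\<mu> (1 + x, 1) = C * zpow H H' (1 + x)"
      using all[of "1 + x" 1] x by (auto simp: Y2_def)
    then have "series2_sum E02 x 1 (C * zpow H H' (1 + x))"
      using sum02[of x 1] x by simp
    then show "((\<lambda>(r, s). E02 r s (H - r) (H' - s) * zpow r s x) has_sum C * zpow H H' (1 + x)) UNIV"
      by (subst (asm) series2_sum_line[of _ H H']) (use E02_supp in auto)
    have "((\<lambda>q. C * (case q of (i, j) \<Rightarrow> of_real ((H gchoose i) * (-1) ^ i) * of_real ((H' gchoose j) * (-1) ^ j)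
            * ((- x) ^ i * cnj (- x) ^ j))) has_sum C * zpow H H' (1 - - x)) UNIV"
      using x by (intro has_sum_cmult_right zpow_binomial H) auto
    moreover have "C * (of_real ((H gchoose i) * (-1) ^ i) * of_real ((H' gchoose j) * (-1) ^ j)
            * ((- x) ^ i * cnj (- x) ^ j)) = of_real ((H gchoose i) * (H' gchoose j)) * C * (x ^ i * cnj x ^ j)" for i j
    proof -
      have sgn: "(- 1) ^ k * (- y) ^ k = y ^ k" for y :: complex and k
        by (simp flip: power_mult_distrib)
      have "C * (of_real ((H gchoose i) * (-1) ^ i) * of_real ((H' gchoose j) * (-1) ^ j)
            * ((- x) ^ i * cnj (- x) ^ j)) = of_real ((H gchoose i) * (H' gchoose j)) * C *
            (((- 1) ^ i * (- x) ^ i) * ((- 1) ^ j * (- cnj x) ^ j))"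
        by (simp only: of_real_mult of_real_power of_real_minus of_real_1 complex_cnj_minus mult_ac)
      then show ?thesis by (simp only: sgn)
    qed
    ultimately
    show "((\<lambda>(i, j). of_real ((H gchoose i) * (H' gchoose j)) * C * (x ^ i * cnj x ^ j)) has_sum
        C * zpow H H' (1 + x)) UNIV"
      by (simp only: case_prod_unfold diff_minus_eq_add)
  qed (use E02_supp \<delta> in auto)
qed

lemma has_sum_sum:
  fixes f :: "'i \<Rightarrow> 'a \<Rightarrow> 'b::{topological_comm_monoid_add}"
  assumes "\<And>i. i \<in> I \<Longrightarrow> (f i has_sum v i) A"
  shows "((\<lambda>x. \<Sum>i\<in>I. f i x) has_sum (\<Sum>i\<in>I. v i)) A"
  using assms by (induction I rule: infinite_finite_induct) (auto intro: has_sum_add)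

text \<open>
  If the expansion in \<open>\<bar>z\<^sub>2\<bar> > \<bar>z\<^sub>1 - z\<^sub>2\<bar>\<close> is a finite sum of terms \<open>z\<^sub>0\<^sup>H\<^sup>-\<^sup>i z\<^sub>2\<^sup>i\<close> (times conjugates), then the
  leading coefficient in \<open>\<bar>z\<^sub>2\<bar> > \<bar>z\<^sub>1\<bar>\<close> is its value at \<open>z\<^sub>1 = 0\<close>, that is at
  \<open>z\<^sub>0 = - z\<^sub>2\<close>.
\<close>

lemma GCor2_leading_coefficient:
  assumes \<mu>: "\<mu> \<in> GCor2" and E02: "gcor_expands gcor_exp_02 \<mu> E02" and E21: "gcor_expands gcor_exp_21 \<mu> E21"
    and H: "H - H' \<in> \<int>"
    and E21_supp: "\<And>r s r' s'. E21 r s r' s' \<noteq> 0 \<Longrightarrow> r + r' = H \<and> s + s' = H' \<and> r \<in> \<nat> \<and> s \<in> \<nat>"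
    and E02_supp: "\<And>r s r' s'. E02 r s r' s' \<noteq> 0 \<Longrightarrow> r + r' = H \<and> s + s' = H' \<and> r' \<in> \<nat> \<and> s' \<in> \<nat>"
    and D: "finite D" "\<And>i j. E02 (H - real i) (H' - real j) (real i) (real j) \<noteq> 0 \<Longrightarrow> (i, j) \<in> D"
  shows "E21 0 0 H H' = (\<Sum>(i, j)\<in>D.
    formal_neg (\<lambda>r s. E02 r s (real i) (real j)) (H - real i) (H' - real j))"
proof -
  obtain \<epsilon> where \<epsilon>: "\<epsilon> > 0" and sum21: "\<And>x y. 0 < norm x \<Longrightarrow> norm x < \<epsilon> * norm y \<Longrightarrow>
      series2_sum E21 x y (\<mu> (x, y))"
    using gcor_expands_sum[OF E21 gcor_exp_21_sum] by blast
  obtain \<delta> where \<delta>: "\<delta> > 0" and sum02: "\<And>x y. 0 < norm x \<Longrightarrow> norm x < \<delta> * norm y \<Longrightarrow>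
      series2_sum E02 x y (\<mu> (y + x, y))"
    using gcor_expands_sum[OF E02 gcor_exp_02_sum] by blast
  define e where "e = (\<lambda>(i, j). E02 (H - real i) (H' - real j) (real i) (real j))"
  define e' where "e' = (\<lambda>(i, j). formal_neg (\<lambda>r s. E02 r s (real i) (real j)) (H - real i) (H' - real j))"
  \<comment> \<open>the finite expansion in \<open>z1 - z2\<close> and \<open>z2\<close>, as a function on all of \<open>Y2\<close>\<close>
  define g where "g = (\<lambda>(z1, z2). \<Sum>q\<in>D. e q *
    zpow (H - real (fst q)) (H' - real (snd q)) (z1 - z2) * zpow (real (fst q)) (real (snd q)) z2)"
  have int: "H - real i - (H' - real j) \<in> \<int>" for i j
    using Ints_diff[OF H Ints_diff[OF Ints_of_nat Ints_of_nat, of i j]] by (simp add: algebra_simps)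
  have near: "\<mu> (y + x, y) = g (y + x, y)" if xy: "0 < norm x" "norm x < \<delta> * norm y" for x y
  proof (rule has_sum_unique)
    show "((\<lambda>(r, s, r', s'). E02 r s r' s' * zpow r s x * zpow r' s' y) has_sum \<mu> (y + x, y)) UNIV"
      using sum02[OF xy] by (simp add: series2_sum_def)
    let ?k = "\<lambda>(i, j). (H - real i, H' - real j, real i, real j)"
    show "((\<lambda>(r, s, r', s'). E02 r s r' s' * zpow r s x * zpow r' s' y) has_sum g (y + x, y)) UNIV"
    proof (rule has_sum_finite_neutralI[of "?k ` D"])
      fix q assume q: "q \<in> UNIV - ?k ` D"
      obtain r s r' s' where [simp]: "q = (r, s, r', s')" by (metis surj_pair)
      have "E02 r s r' s' = 0"
      proof (rule ccontr)
        assume nz: "E02 r s r' s' \<noteq> 0"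
        then obtain i j where "r' = real i" "s' = real j" "r = H - real i" "s = H' - real j"
          using E02_supp[OF nz] by (auto simp: Nats_def)
        moreover from this have "(i, j) \<in> D" using D(2)[of i j] nz by simp
        ultimately have "q \<in> ?k ` D" by force
        then show False using q by blast
      qed
      then show "(case q of (r, s, r', s') \<Rightarrow> E02 r s r' s' * zpow r s x * zpow r' s' y) = 0" by simp
    next
      have "inj_on ?k D" by (auto simp: inj_on_def)
      then show "g (y + x, y) = (\<Sum>q\<in>?k ` D. case q of (r, s, r', s') \<Rightarrow> E02 r s r' s' * zpow r s x * zpow r' s' y)"
        by (subst sum.reindex) (auto simp: g_def e_def case_prod_unfold)
    qed (use D(1) in auto)
  qed
  have g_an: "axis_analytic_on (\<lambda>p. g (w, w * p)) (- {0, 1})" if "w \<noteq> 0" for w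
  proof -
    have "zpow r s (w - w * p) = zpow r s (- w) * zpow r s (p - 1)" for r s p
      by (simp add: algebra_simps flip: zpow_mult)
    moreover have "zpow r s (w * p) = zpow r s w * zpow r s (p - 0)" for r s p
      by (simp add: zpow_mult)
    moreover have "real i - real j \<in> \<int>" for i j by simp
    ultimately show ?thesis
      unfolding g_def case_prod_conv
      by (simp only:) (intro axis_analytic_on_sum axis_analytic_on_mult axis_analytic_on_const int
          axis_analytic_on_subset[OF axis_analytic_on_zpow], auto)
  qed
  have all: "\<mu> (z1, z2) = g (z1, z2)" if "(z1, z2) \<in> Y2" for z1 z2
    by (rule GCor2_eqI_02[OF \<mu> g_an \<delta> _ that]) (auto simp: near)
  \<comment> \<open>the coefficients of \<open>g (x, 1)\<close> as a power series in \<open>x\<close> and its conjugate\<close>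
  define c where "c k l = (\<Sum>q\<in>D. e' q *
    (of_real ((H - real (fst q) gchoose k) * (-1) ^ k) * of_real ((H' - real (snd q) gchoose l) * (-1) ^ l)))" for k l
  have "E21 (real 0) (real 0) (H - real 0) (H' - real 0) = c 0 0"
  proof (rule nat_support_coeff_unique[where A = "\<lambda>r s. E21 r s (H - r) (H' - s)" and R = "min \<epsilon> 1"
        and g = "\<lambda>x. g (x, 1)" and c = c])
    fix x :: complex assume x: "0 < norm x" "norm x < min \<epsilon> 1"
    then have "\<mu> (x, 1) = g (x, 1)"
      by (intro all) (auto simp: Y2_def)
    then have "series2_sum E21 x 1 (g (x, 1))"
      using sum21[of x 1] x by simp
    then show "((\<lambda>(r, s). E21 r s (H - r) (H' - s) * zpow r s x) has_sum g (x, 1)) UNIV"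
      by (subst (asm) series2_sum_line[of _ H H']) (use E21_supp in auto)
    have "g (x, 1) = (\<Sum>q\<in>D. e' q * zpow (H - real (fst q)) (H' - real (snd q)) (1 - x))"
    proof -
      have "e q * zpow (H - real (fst q)) (H' - real (snd q)) (- (1 - x)) =
          e' q * zpow (H - real (fst q)) (H' - real (snd q)) (1 - x)" for q
        by (subst zpow_minus) (simp add: e_def e'_def formal_neg_def case_prod_unfold)
      then show ?thesis by (simp add: g_def)
    qed
    moreover have "((\<lambda>z. \<Sum>q\<in>D. e' q * (case z of (k, l) \<Rightarrow>
        of_real ((H - real (fst q) gchoose k) * (-1) ^ k) *
        of_real ((H' - real (snd q) gchoose l) * (-1) ^ l) * (x ^ k * cnj x ^ l))) has_sum
        (\<Sum>q\<in>D. e' q * zpow (H - real (fst q)) (H' - real (snd q)) (1 - x))) UNIV"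
      using x by (intro has_sum_sum has_sum_cmult_right zpow_binomial int) auto
    ultimately show "((\<lambda>(k, l). c k l * (x ^ k * cnj x ^ l)) has_sum g (x, 1)) UNIV"
      by (simp add: c_def case_prod_unfold sum_distrib_right mult.assoc)
  qed (use E21_supp \<epsilon> in auto)
  then show ?thesis by (simp add: c_def e'_def case_prod_unfold)
qed

section \<open>Homogeneous components\<close>

context full_vertex_algebra
begin

lemma Y_add_left: "Y (a + b) r s c = Y a r s c + Y b r s c"
  by (rule module_hom.add[OF Vector_Spaces.linear.axioms(3)[OF Y_linear]])

lemma Y_zero_left: "Y 0 r s c = 0"
  by (rule module_hom.zero[OF Vector_Spaces.linear.axioms(3)[OF Y_linear]])

lemma Y_scale_left: "Y (smul t a) r s c = smul t (Y a r s c)"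
  by (rule module_hom.scale[OF Vector_Spaces.linear.axioms(3)[OF Y_linear]])

lemma Y_uminus_left: "Y (- a) r s c = - Y a r s c"
  by (rule module_hom.neg[OF Vector_Spaces.linear.axioms(3)[OF Y_linear]])

lemma Y_sum_left: "Y (\<Sum>i\<in>I. f i) r s c = (\<Sum>i\<in>I. Y (f i) r s c)"
  by (rule module_hom.sum[OF Vector_Spaces.linear.axioms(3)[OF Y_linear]])

lemma Y_add_right: "Y a r s (b + c) = Y a r s b + Y a r s c"
  by (rule module_hom.add[OF Vector_Spaces.linear.axioms(3)[OF Y_endo]])

lemma Y_zero_right: "Y a r s 0 = 0"
  by (rule module_hom.zero[OF Vector_Spaces.linear.axioms(3)[OF Y_endo]])

lemma Y_integral: "Y a r s b \<noteq> 0 \<Longrightarrow> r - s \<in> \<int>"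
  using Y_formal_series[of a] by (auto simp: formal_series_def fun_eq_iff)

lemma Y_bounded_below:
  obtains N where "\<And>r s. Y a r s b \<noteq> 0 \<Longrightarrow> r \<ge> N \<and> s \<ge> N"
proof -
  obtain N where N: "\<And>r s. r \<ge> N \<or> s \<ge> N \<Longrightarrow> mode Y a r s b = 0"
    using FV1[of a b] by blast
  have "Y a r s b = 0" if "- r - 1 \<ge> N \<or> - s - 1 \<ge> N" for r s
    using N[OF that] by (simp add: mode_def)
  then have "r \<ge> - N - 1 \<and> s \<ge> - N - 1" if "Y a r s b \<noteq> 0" for r s
    using that by (smt (verit))
  then show ?thesis by (rule that)
qed

lemma Y_degree:
  assumes "a \<in> F h h'" "b \<in> F k k'"
  shows "Y a r s b \<in> F (h + k + r) (h' + k' + s)"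
  using FV6[OF assms, of "- r - 1" "- s - 1"] by (simp add: mode_def add.assoc)

lemma homogeneous_induct:
  assumes zero: "P 0" and add: "\<And>v w. P v \<Longrightarrow> P w \<Longrightarrow> P (v + w)"
    and hom: "\<And>h h' v. v \<in> F h h' \<Longrightarrow> P v"
  shows "P v"
proof -
  obtain w where w: "finite {k. w k \<noteq> 0}" "\<forall>h h'. w (h, h') \<in> F h h'" "v = (\<Sum>k | w k \<noteq> 0. w k)"
    using grading_direct_sum by blast
  have hom_w: "P (w k)" for k
    using w(2) by (metis hom surj_pair)
  have "P (\<Sum>k\<in>K. w k)" if "finite K" for K
    using that by induction (simp_all add: zero add hom_w)
  then show ?thesis using w by simp
qed

text \<open>The components of a vector in the graded pieces.\<close>

definition component :: "'v \<Rightarrow> real \<times> real \<Rightarrow> 'v" where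
  "component v = (THE w. finite {k. w k \<noteq> 0} \<and> (\<forall>h h'. w (h, h') \<in> F h h') \<and> v = (\<Sum>k | w k \<noteq> 0. w k))"

lemma component:
  "finite {k. component v k \<noteq> 0}" "component v (h, h') \<in> F h h'" "v = (\<Sum>k | component v k \<noteq> 0. component v k)"
  using theI'[OF grading_direct_sum[of v]] by (auto simp: component_def[symmetric])

lemma component_eqI:
  assumes "finite K" "\<And>k. k \<notin> K \<Longrightarrow> w k = 0" "\<And>h h'. w (h, h') \<in> F h h'" "v = (\<Sum>k\<in>K. w k)"
  shows "component v = w"
proof -
  have sub: "{k. w k \<noteq> 0} \<subseteq> K" using assms(2) by blast
  have "v = (\<Sum>k | w k \<noteq> 0. w k)"
    unfolding assms(4) by (rule sum.mono_neutral_right[OF assms(1) sub]) auto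
  with finite_subset[OF sub assms(1)] assms(3)
  show ?thesis
    unfolding component_def by (intro the1_equality[OF grading_direct_sum]) auto
qed

lemma sum_component:
  assumes "finite K" "{k. component v k \<noteq> 0} \<subseteq> K"
  shows "v = (\<Sum>k\<in>K. component v k)"
  by (subst component(3)) (rule sum.mono_neutral_left[OF assms], auto)

lemma component_add: "component (v + v') k = component v k + component v' k"
proof -
  let ?K = "{k. component v k \<noteq> 0} \<union> {k. component v' k \<noteq> 0}"
  have "v + v' = (\<Sum>k\<in>?K. component v k + component v' k)"
    using component(1) sum_component[of ?K v] sum_component[of ?K v'] by (simp add: sum.distrib)
  then have "component (v + v') = (\<lambda>k. component v k + component v' k)"
    by (intro component_eqI[of ?K]) (auto intro: component subspace_add[OF grading_subspace])
  then show ?thesis by simp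
qed

lemma component_scale: "component (smul t v) k = smul t (component v k)"
proof -
  let ?K = "{k. component v k \<noteq> 0}"
  have "smul t v = (\<Sum>k\<in>?K. smul t (component v k))"
    by (subst component(3)) (rule scale_sum_right)
  then have "component (smul t v) = (\<lambda>k. smul t (component v k))"
    by (intro component_eqI[of ?K]) (auto intro: component subspace_scale[OF grading_subspace])
  then show ?thesis by simp
qed

lemma component_homogeneous:
  assumes "v \<in> F h h'"
  shows "component v k = (if k = (h, h') then v else 0)"
proof -
  have "component v = (\<lambda>k. if k = (h, h') then v else 0)"
    by (rule component_eqI[of "{(h, h')}"]) (use assms subspace_0[OF grading_subspace] in auto)
  then show ?thesis by simp
qed

text \<open>
  Functionals concentrated in the degree \<open>(k, k')\<close> separate the vectors of that degree: compose the
  projection onto the component with a functional on the whole space.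
\<close>

lemma homogeneous_eqI:
  assumes x: "x \<in> F k k'" and y: "y \<in> F k k'"
    and eq: "\<And>u. u \<in> restricted_dual smul F \<Longrightarrow> Vector_Spaces.linear smul (*) u \<Longrightarrow>
      (\<And>h h' v. v \<in> F h h' \<Longrightarrow> u v \<noteq> 0 \<Longrightarrow> h = k \<and> h' = k') \<Longrightarrow> u x = u y"
  shows "x = y"
proof (rule ccontr)
  assume "x \<noteq> y"
  interpret cx: vector_space "(*) :: complex \<Rightarrow> complex \<Rightarrow> complex"
    by unfold_locales (auto simp: algebra_simps)
  interpret vp: vector_space_pair smul "(*) :: complex \<Rightarrow> complex \<Rightarrow> complex" ..
  have "independent {x - y}"
    using \<open>x \<noteq> y\<close> by (simp add: dependent_single)
  then obtain \<phi> where \<phi>: "Vector_Spaces.linear smul (*) \<phi>" "\<phi> (x - y) = 1"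
    using vp.linear_independent_extend[of "{x - y}" "\<lambda>_. 1"] by auto
  define u where "u v = \<phi> (component v (k, k'))" for v
  have u_lin: "Vector_Spaces.linear smul (*) u"
    using vp.linear_add[OF \<phi>(1)] vp.linear_scale[OF \<phi>(1)]
    by unfold_locales (simp_all add: u_def component_add component_scale)
  have conc: "h = k \<and> h' = k'" if "v \<in> F h h'" "u v \<noteq> 0" for h h' v
    using that vp.linear_0[OF \<phi>(1)] by (auto simp: u_def component_homogeneous split: if_splits)
  then have "{(h, h'). \<exists>v\<in>F h h'. u v \<noteq> 0} \<subseteq> {(k, k')}" by auto
  then have "u \<in> restricted_dual smul F"
    using u_lin finite_subset unfolding restricted_dual_def by blast
  then have "u x = u y" using u_lin conc by (rule eq)
  then show False
    using \<phi>(2) vp.linear_diff[OF \<phi>(1)] by (simp add: u_def component_homogeneous[OF x] component_homogeneous[OF y])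
qed

section \<open>Translation and skew-symmetry\<close>

lemma gchoose_shift_one: "(1 + real i) gchoose i = real i + 1"
  using binomial_gbinomial[of "Suc i" i, where ?'a = real] by simp

text \<open>
  The coefficient of \<open>z\<^sup>i zbar\<^sup>j\<close> in \<open>Y(a, z) vac\<close> acts as the divided derivative of \<open>Y(a, z)\<close> of
  order \<open>(i, j)\<close>.
\<close>

lemma Y_mode_vac_homogeneous:
  assumes a: "a \<in> F h h'" and c: "c \<in> F l l'"
  shows "Y (Y a (real i) (real j) vac) r s c =
    smul (of_real ((r + real i gchoose i) * (s + real j gchoose j))) (Y a (r + real i) (s + real j) c)"
proof (rule homogeneous_eqI)
  let ?H = "r + real i" and ?H' = "s + real j"
  let ?k = "h + l + ?H" and ?k' = "h' + l' + ?H'"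
  show "Y (Y a (real i) (real j) vac) r s c \<in> F ?k ?k'"
    using Y_degree[OF Y_degree[OF a vac_grading] c, of "real i" "real j" r s] by (simp add: algebra_simps)
  show "smul (of_real ((?H gchoose i) * (?H' gchoose j))) (Y a ?H ?H' c) \<in> F ?k ?k'"
    by (rule subspace_scale[OF grading_subspace Y_degree[OF a c]])
  fix u assume u: "u \<in> restricted_dual smul F" "Vector_Spaces.linear smul (*) u"
    and conc: "\<And>g g' v. v \<in> F g g' \<Longrightarrow> u v \<noteq> 0 \<Longrightarrow> g = ?k \<and> g' = ?k'"
  note u_hom = Vector_Spaces.linear.axioms(3)[OF u(2)]
  note u_0 = module_hom.zero[OF u_hom]
  show "u (Y (Y a (real i) (real j) vac) r s c) =
      u (smul (of_real ((?H gchoose i) * (?H' gchoose j))) (Y a ?H ?H' c))"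
  proof (cases "?H - ?H' \<in> \<int>")
    case False
    \<comment> \<open>both sides vanish\<close>
    have "r - s \<notin> \<int>"
    proof
      assume "r - s \<in> \<int>"
      from Ints_add[OF this Ints_diff[OF Ints_of_nat Ints_of_nat, of i j]] False
      show False by (simp add: algebra_simps)
    qed
    then show ?thesis using False Y_integral by (metis scale_zero_right)
  next
    case True
    obtain \<mu> where \<mu>: "\<mu> \<in> GCor2"
      "gcor_expands gcor_exp_02 \<mu> (\<lambda>r\<^sub>0 s\<^sub>0 r\<^sub>2 s\<^sub>2. u (Y (Y a r\<^sub>0 s\<^sub>0 vac) r\<^sub>2 s\<^sub>2 c))"
      "gcor_expands gcor_exp_21 \<mu> (\<lambda>r\<^sub>1 s\<^sub>1 r\<^sub>2 s\<^sub>2. u (Y vac r\<^sub>2 s\<^sub>2 (Y a r\<^sub>1 s\<^sub>1 c)))"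
      using FV5[OF u(1), of a vac c] by blast
    have "u (Y (Y a (real i) (real j) vac) (?H - real i) (?H' - real j) c) =
        of_real ((?H gchoose i) * (?H' gchoose j)) * u (Y a ?H ?H' c)"
    proof (rule GCor2_power_expansion[OF \<mu> True])
      fix r1 s1 r2 s2
      have "u (Y a r1 s1 c) = 0" if "\<not> (r1 = ?H \<and> s1 = ?H')"
        using conc[OF Y_degree[OF a c, of r1 s1]] that by auto
      then show "u (Y vac r2 s2 (Y a r1 s1 c)) =
          (if r1 = ?H \<and> s1 = ?H' \<and> r2 = 0 \<and> s2 = 0 then u (Y a ?H ?H' c) else 0)"
        by (auto simp: FV4 u_0)
    next
      fix r0 s0 r2 s2 assume nz: "u (Y (Y a r0 s0 vac) r2 s2 c) \<noteq> 0"
      then have "Y a r0 s0 vac \<noteq> 0" using Y_zero_left u_0 by metis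
      moreover have "h + 0 + r0 + l + r2 = ?k \<and> h' + 0 + s0 + l' + s2 = ?k'"
        by (rule conc[OF Y_degree[OF Y_degree[OF a vac_grading] c] nz])
      ultimately show "r0 + r2 = ?H \<and> s0 + s2 = ?H' \<and> r0 \<in> \<nat> \<and> s0 \<in> \<nat>"
        using FV3_power_series by auto
    qed
    then show ?thesis by (simp add: module_hom.scale[OF u_hom])
  qed
qed

lemma Y_mode_vac:
  "Y (Y a (real i) (real j) vac) r s c =
    smul (of_real ((r + real i gchoose i) * (s + real j gchoose j))) (Y a (r + real i) (s + real j) c)"
proof (induction a rule: homogeneous_induct)
  case (3 h h' a)
  show ?case
    by (induction c rule: homogeneous_induct)
       (simp_all add: Y_zero_right Y_add_right scale_right_distrib Y_mode_vac_homogeneous[OF 3])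
qed (simp_all add: Y_zero_left Y_add_left scale_right_distrib)

text \<open>
  The coefficient at \<open>(r, s)\<close> of skew-symmetry, with \<open>Y(v, z) vac\<close> in place of
  \<open>exp (z D + zbar D') v\<close>. The finite sum runs over any sufficiently large index set, which makes the statement
  additive in \<open>a\<close> and \<open>b\<close>.
\<close>

definition skew_symmetric_at :: "'v \<Rightarrow> 'v \<Rightarrow> real \<Rightarrow> real \<Rightarrow> bool" where
  "skew_symmetric_at a b r s \<longleftrightarrow> (\<exists>M. \<forall>S. finite S \<longrightarrow> {..<M} \<times> {..<M} \<subseteq> S \<longrightarrow>
     Y b r s a = (\<Sum>(i, j)\<in>S. Y (formal_neg (\<lambda>r s. Y a r s b) (r - real i) (s - real j)) (real i) (real j) vac))"

lemma skew_symmetric_at_homogeneous: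
  assumes a: "a \<in> F h h'" and b: "b \<in> F l l'"
  shows "skew_symmetric_at a b H H'"
proof -
  obtain N where N: "\<And>r s. Y a r s b \<noteq> 0 \<Longrightarrow> r \<ge> N \<and> s \<ge> N"
    using Y_bounded_below by blast
  define M where "M = Suc (nat \<lfloor>max (H - N) (H' - N)\<rfloor>)"
  have M: "i < M \<and> j < M" if nz: "Y a (H - real i) (H' - real j) b \<noteq> 0" for i j
  proof -
    have "real i \<le> max (H - N) (H' - N)" "real j \<le> max (H - N) (H' - N)"
      using N[OF nz] by auto
    then show ?thesis unfolding M_def less_Suc_eq_le by (intro conjI le_nat_floor)
  qed
  show ?thesis
    unfolding skew_symmetric_at_def
  proof (intro exI[of _ M] allI impI)
    fix S :: "(nat \<times> nat) set" assume S: "finite S" "{..<M} \<times> {..<M} \<subseteq> S"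
    let ?A = "formal_neg (\<lambda>r s. Y a r s b)"
    let ?k = "h + l + H" and ?k' = "h' + l' + H'"
    show "Y b H H' a = (\<Sum>(i, j)\<in>S. Y (?A (H - real i) (H' - real j)) (real i) (real j) vac)"
    proof (rule homogeneous_eqI)
      show "Y b H H' a \<in> F ?k ?k'"
        using Y_degree[OF b a, of H H'] by (simp add: algebra_simps)
      have A_degree: "?A r s \<in> F (h + l + r) (h' + l' + s)" for r s
        using Y_degree[OF a b, of r s] subspace_neg[OF grading_subspace] by (simp add: formal_neg_def)
      have "Y (?A (H - real i) (H' - real j)) (real i) (real j) vac \<in> F ?k ?k'" for i j
        using Y_degree[OF A_degree vac_grading, of "H - real i" "H' - real j" "real i" "real j"] by (simp add: add.assoc)
      then show "(\<Sum>(i, j)\<in>S. Y (?A (H - real i) (H' - real j)) (real i) (real j) vac) \<in> F ?k ?k'"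
        by (intro subspace_sum[OF grading_subspace]) auto
      fix u assume u: "u \<in> restricted_dual smul F" "Vector_Spaces.linear smul (*) u"
        and conc: "\<And>g g' v. v \<in> F g g' \<Longrightarrow> u v \<noteq> 0 \<Longrightarrow> g = ?k \<and> g' = ?k'"
      note u_hom = Vector_Spaces.linear.axioms(3)[OF u(2)]
      note u_0 = module_hom.zero[OF u_hom]
      have u_sum: "u (\<Sum>(i, j)\<in>S. Y (?A (H - real i) (H' - real j)) (real i) (real j) vac) =
        (\<Sum>(i, j)\<in>S. formal_neg (\<lambda>r s. u (Y (Y a r s b) (real i) (real j) vac)) (H - real i) (H' - real j))"
        by (simp add: module_hom.sum[OF u_hom] case_prod_unfold formal_neg_def Y_uminus_left
            module_hom.neg[OF u_hom] if_distrib[of "\<lambda>v. u (Y v _ _ vac)"] cong: if_cong)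
      show "u (Y b H H' a) = u (\<Sum>(i, j)\<in>S. Y (?A (H - real i) (H' - real j)) (real i) (real j) vac)"
      proof (cases "H - H' \<in> \<int>")
        case False
        have "Y a (H - real i) (H' - real j) b = 0" for i j
        proof (rule ccontr)
          assume "Y a (H - real i) (H' - real j) b \<noteq> 0"
          from Ints_add[OF Y_integral[OF this] Ints_diff[OF Ints_of_nat Ints_of_nat, of i j]] False
          show False by simp
        qed
        then have "u (\<Sum>(i, j)\<in>S. Y (?A (H - real i) (H' - real j)) (real i) (real j) vac) = 0"
          unfolding u_sum by (simp add: formal_neg_def Y_zero_left u_0 case_prod_unfold cong: if_cong)
        moreover have "Y b H H' a = 0" using False Y_integral by blast
        ultimately show ?thesis by (simp add: u_0)
      next
        case True
        obtain \<mu> where \<mu>: "\<mu> \<in> GCor2"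
          "gcor_expands gcor_exp_02 \<mu> (\<lambda>r\<^sub>0 s\<^sub>0 r\<^sub>2 s\<^sub>2. u (Y (Y a r\<^sub>0 s\<^sub>0 b) r\<^sub>2 s\<^sub>2 vac))"
          "gcor_expands gcor_exp_21 \<mu> (\<lambda>r\<^sub>1 s\<^sub>1 r\<^sub>2 s\<^sub>2. u (Y b r\<^sub>2 s\<^sub>2 (Y a r\<^sub>1 s\<^sub>1 vac)))"
          using FV5[OF u(1), of a b vac] by blast
        have "u (Y b H H' (Y a 0 0 vac)) = (\<Sum>(i, j)\<in>S.
            formal_neg (\<lambda>r s. u (Y (Y a r s b) (real i) (real j) vac)) (H - real i) (H' - real j))"
        proof (rule GCor2_leading_coefficient[OF \<mu> True _ _ S(1)])
          fix r1 s1 r2 s2 assume nz: "u (Y b r2 s2 (Y a r1 s1 vac)) \<noteq> 0"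
          then have "Y a r1 s1 vac \<noteq> 0" using Y_zero_right u_0 by metis
          moreover have "l + (h + 0 + r1) + r2 = ?k \<and> l' + (h' + 0 + s1) + s2 = ?k'"
            by (rule conc[OF Y_degree[OF b Y_degree[OF a vac_grading]] nz])
          ultimately show "r1 + r2 = H \<and> s1 + s2 = H' \<and> r1 \<in> \<nat> \<and> s1 \<in> \<nat>"
            using FV3_power_series by auto
        next
          fix r0 s0 r2 s2 assume nz: "u (Y (Y a r0 s0 b) r2 s2 vac) \<noteq> 0"
          then have "Y (Y a r0 s0 b) r2 s2 vac \<noteq> 0" using u_0 by metis
          moreover have "h + l + r0 + 0 + r2 = ?k \<and> h' + l' + s0 + 0 + s2 = ?k'"
            by (rule conc[OF Y_degree[OF Y_degree[OF a b] vac_grading] nz])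
          ultimately show "r0 + r2 = H \<and> s0 + s2 = H' \<and> r2 \<in> \<nat> \<and> s2 \<in> \<nat>"
            using FV3_power_series by auto
        next
          fix i j assume "u (Y (Y a (H - real i) (H' - real j) b) (real i) (real j) vac) \<noteq> 0"
          then have "Y a (H - real i) (H' - real j) b \<noteq> 0" using Y_zero_left u_0 by metis
          then show "(i, j) \<in> S" using M S(2) by blast
        qed
        then show ?thesis by (simp add: u_sum FV3_constant_term)
      qed
    qed
  qed
qed

lemma skew_symmetric_at_add_left:
  assumes "skew_symmetric_at a b r s" "skew_symmetric_at a' b r s"
  shows "skew_symmetric_at (a + a') b r s"
proof -
  obtain M M' where M: "\<And>S. finite S \<Longrightarrow> {..<M} \<times> {..<M} \<subseteq> S \<Longrightarrow>
      Y b r s a = (\<Sum>(i, j)\<in>S. Y (formal_neg (\<lambda>r s. Y a r s b) (r - real i) (s - real j)) (real i) (real j) vac)"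
    and M': "\<And>S. finite S \<Longrightarrow> {..<M'} \<times> {..<M'} \<subseteq> S \<Longrightarrow>
      Y b r s a' = (\<Sum>(i, j)\<in>S. Y (formal_neg (\<lambda>r s. Y a' r s b) (r - real i) (s - real j)) (real i) (real j) vac)"
    using assms unfolding skew_symmetric_at_def by blast
  have neg: "formal_neg (\<lambda>r s. Y (a + a') r s b) r s =
      formal_neg (\<lambda>r s. Y a r s b) r s + formal_neg (\<lambda>r s. Y a' r s b) r s" for r s
    by (simp add: formal_neg_def Y_add_left)
  show ?thesis
    unfolding skew_symmetric_at_def
  proof (intro exI[of _ "max M M'"] allI impI)
    fix S :: "(nat \<times> nat) set"
    assume S: "finite S" "{..<max M M'} \<times> {..<max M M'} \<subseteq> S"
    then have "{..<M} \<times> {..<M} \<subseteq> S" "{..<M'} \<times> {..<M'} \<subseteq> S" by auto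
    then show "Y b r s (a + a') =
      (\<Sum>(i, j)\<in>S. Y (formal_neg (\<lambda>r s. Y (a + a') r s b) (r - real i) (s - real j)) (real i) (real j) vac)"
      using M[OF S(1)] M'[OF S(1)] unfolding Y_add_right neg
      by (simp only: Y_add_left case_prod_unfold sum.distrib)
  qed
qed

lemma skew_symmetric_at_add_right:
  assumes "skew_symmetric_at a b r s" "skew_symmetric_at a b' r s"
  shows "skew_symmetric_at a (b + b') r s"
proof -
  obtain M M' where M: "\<And>S. finite S \<Longrightarrow> {..<M} \<times> {..<M} \<subseteq> S \<Longrightarrow>
      Y b r s a = (\<Sum>(i, j)\<in>S. Y (formal_neg (\<lambda>r s. Y a r s b) (r - real i) (s - real j)) (real i) (real j) vac)"
    and M': "\<And>S. finite S \<Longrightarrow> {..<M'} \<times> {..<M'} \<subseteq> S \<Longrightarrow>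
      Y b' r s a = (\<Sum>(i, j)\<in>S. Y (formal_neg (\<lambda>r s. Y a r s b') (r - real i) (s - real j)) (real i) (real j) vac)"
    using assms unfolding skew_symmetric_at_def by blast
  have neg: "formal_neg (\<lambda>r s. Y a r s (b + b')) r s =
      formal_neg (\<lambda>r s. Y a r s b) r s + formal_neg (\<lambda>r s. Y a r s b') r s" for r s
    by (simp add: formal_neg_def Y_add_right)
  show ?thesis
    unfolding skew_symmetric_at_def
  proof (intro exI[of _ "max M M'"] allI impI)
    fix S :: "(nat \<times> nat) set"
    assume S: "finite S" "{..<max M M'} \<times> {..<max M M'} \<subseteq> S"
    then have "{..<M} \<times> {..<M} \<subseteq> S" "{..<M'} \<times> {..<M'} \<subseteq> S" by auto
    then show "Y (b + b') r s a =
      (\<Sum>(i, j)\<in>S. Y (formal_neg (\<lambda>r s. Y a r s (b + b')) (r - real i) (s - real j)) (real i) (real j) vac)"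
      using M[OF S(1)] M'[OF S(1)] unfolding neg
      by (simp only: Y_add_left case_prod_unfold sum.distrib)
  qed
qed

lemma skew_symmetry: "skew_symmetric_at a b r s"
proof (induction a rule: homogeneous_induct)
  case 1
  show ?case by (simp add: skew_symmetric_at_def formal_neg_def Y_zero_left Y_zero_right case_prod_unfold cong: if_cong)
next
  case (2 a a')
  then show ?case by (rule skew_symmetric_at_add_left)
next
  case (3 h h' a)
  show ?case
  proof (induction b rule: homogeneous_induct)
    case 1
    show ?case by (simp add: skew_symmetric_at_def formal_neg_def Y_zero_left Y_zero_right case_prod_unfold cong: if_cong)
  qed (auto intro: skew_symmetric_at_add_right skew_symmetric_at_homogeneous[OF 3])
qed

abbreviation (input) "D \<equiv> translation Y vac"
abbreviation (input) "D' \<equiv> translation_bar Y vac"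

lemma Y_D: "Y (D a) r s c = smul (of_real (r + 1)) (Y a (r + 1) s c)"
  using Y_mode_vac[of a 1 0 r s c] by (simp add: translation_def)

lemma Y_D': "Y (D' a) r s c = smul (of_real (s + 1)) (Y a r (s + 1) c)"
  using Y_mode_vac[of a 0 1 r s c] by (simp add: translation_bar_def)

lemma D_mode_vac: "D (Y v (real i) (real j) vac) = smul (of_nat (Suc i)) (Y v (real (Suc i)) (real j) vac)"
  using Y_mode_vac[of v i j 1 0 vac] binomial_gbinomial[of j j, where ?'a = real]
  by (simp add: translation_def gchoose_shift_one add.commute)

lemma D'_mode_vac: "D' (Y v (real i) (real j) vac) = smul (of_nat (Suc j)) (Y v (real i) (real (Suc j)) vac)"
  using Y_mode_vac[of v i j 0 1 vac] binomial_gbinomial[of i i, where ?'a = real]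
  by (simp add: translation_bar_def gchoose_shift_one add.commute)

lemma D_scale: "D (smul t v) = smul t (D v)" and D'_scale: "D' (smul t v) = smul t (D' v)"
  by (simp_all add: translation_def translation_bar_def Y_scale_left)

lemma zSzT_power_translation:
  "i + j = n \<Longrightarrow> zSzT_power D D' n i j v = smul (fact n) (Y v (real i) (real j) vac)"
proof (induction n arbitrary: i j)
  case 0
  then show ?case by (simp add: FV3_constant_term)
next
  case (Suc n)
  have "(if i > 0 then D (zSzT_power D D' n (i - 1) j v) else 0) =
      smul (fact n * of_nat i) (Y v (real i) (real j) vac)"
    using Suc.IH[of "i - 1" j] Suc.prems D_mode_vac[of v "i - 1" j] by (auto simp: D_scale)
  moreover have "(if j > 0 then D' (zSzT_power D D' n i (j - 1) v) else 0) =
      smul (fact n * of_nat j) (Y v (real i) (real j) vac)"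
    using Suc.IH[of i "j - 1"] Suc.prems D'_mode_vac[of v i "j - 1"] by (auto simp: D'_scale)
  ultimately have "zSzT_power D D' (Suc n) i j v =
      smul (fact n * of_nat i + fact n * of_nat j) (Y v (real i) (real j) vac)"
    by (simp add: scale_left_distrib)
  also have "fact n * of_nat i + fact n * of_nat j = (fact (Suc n) :: complex)"
    using Suc.prems by (simp add: algebra_simps flip: of_nat_add distrib_left)
  finally show ?case .
qed

lemma exp_translation: "exp_zSzT smul D D' i j v = Y v (real i) (real j) vac"
  by (simp add: exp_zSzT_def zSzT_power_translation)

lemma skew_symmetry_exp:
  "Y a r s b = power_series_apply (exp_zSzT smul D D') (formal_neg (\<lambda>r s. Y b r s a)) r s"
proof -
  let ?A = "formal_neg (\<lambda>r s. Y b r s a)"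
  obtain N where N: "\<And>r s. Y b r s a \<noteq> 0 \<Longrightarrow> r \<ge> N \<and> s \<ge> N"
    using Y_bounded_below by blast
  then have "\<And>r s. ?A r s \<noteq> 0 \<Longrightarrow> r \<ge> N \<and> s \<ge> N"
    by (auto simp: formal_neg_def split: if_splits)
  then have fin: "finite {(i::nat, j::nat). ?A (r - real i) (s - real j) \<noteq> 0}"
    by (rule finite_bounded_below_support)
  obtain M where M: "\<And>S. finite S \<Longrightarrow> {..<M} \<times> {..<M} \<subseteq> S \<Longrightarrow>
      Y a r s b = (\<Sum>(i, j)\<in>S. Y (?A (r - real i) (s - real j)) (real i) (real j) vac)"
    using skew_symmetry[of b a r s] unfolding skew_symmetric_at_def by blast
  let ?S = "{..<M} \<times> {..<M} \<union> {(i::nat, j::nat). ?A (r - real i) (s - real j) \<noteq> 0}"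
  have "Y a r s b = (\<Sum>(i, j)\<in>?S. Y (?A (r - real i) (s - real j)) (real i) (real j) vac)"
    using fin by (intro M) auto
  also have "\<dots> = (\<Sum>(i, j) | ?A (r - real i) (s - real j) \<noteq> 0. Y (?A (r - real i) (s - real j)) (real i) (real j) vac)"
    using fin by (intro sum.mono_neutral_right) (auto simp: Y_zero_left)
  finally show ?thesis by (simp add: power_series_apply_def exp_translation)
qed

lemma sum_shift_first:
  fixes g :: "nat \<Rightarrow> nat \<Rightarrow> 'v"
  assumes "\<And>j. g 0 j = 0"
  shows "(\<Sum>(i, j)\<in>{..<M} \<times> {..<L}. g (Suc i) j) = (\<Sum>(i, j)\<in>{..<Suc M} \<times> {..<L}. g i j)"
  using assms by (simp add: sum.lessThan_Suc_shift del: sum.lessThan_Suc flip: sum.cartesian_product)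

lemma sum_shift_second:
  fixes g :: "nat \<Rightarrow> nat \<Rightarrow> 'v"
  assumes "\<And>i. g i 0 = 0"
  shows "(\<Sum>(i, j)\<in>{..<M} \<times> {..<L}. g i (Suc j)) = (\<Sum>(i, j)\<in>{..<M} \<times> {..<Suc L}. g i j)"
  using assms by (simp add: sum.lessThan_Suc_shift del: sum.lessThan_Suc flip: sum.cartesian_product)

lemma D_sum: "D (\<Sum>i\<in>I. f i) = (\<Sum>i\<in>I. D (f i))" and D'_sum: "D' (\<Sum>i\<in>I. f i) = (\<Sum>i\<in>I. D' (f i))"
  by (simp_all add: translation_def translation_bar_def Y_sum_left)

lemma skew_symmetry_uniform:
  obtains M where "\<And>S. finite S \<Longrightarrow> {..<M} \<times> {..<M} \<subseteq> S \<Longrightarrow>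
    Y a r s b = (\<Sum>(i, j)\<in>S. Y (formal_neg (\<lambda>r s. Y b r s a) (r - real i) (s - real j)) (real i) (real j) vac)"
  using skew_symmetry[of b a r s] unfolding skew_symmetric_at_def by blast

lemma formal_neg_D:
  "formal_neg (\<lambda>r s. Y (D b) r s a) r s = - smul (of_real (r + 1)) (formal_neg (\<lambda>r s. Y b r s a) (r + 1) s)"
proof -
  have "\<lfloor>r + 1 - s\<rfloor> = \<lfloor>r - s\<rfloor> + 1" by linarith
  then show ?thesis by (simp add: formal_neg_def Y_D)
qed

lemma formal_neg_D':
  "formal_neg (\<lambda>r s. Y (D' b) r s a) r s = - smul (of_real (s + 1)) (formal_neg (\<lambda>r s. Y b r s a) r (s + 1))"
proof -
  have "\<lfloor>r - (s + 1)\<rfloor> = \<lfloor>r - s\<rfloor> - 1" by linarith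
  then show ?thesis by (simp add: formal_neg_def Y_D')
qed

text \<open>
  The coefficients of skew-symmetry differentiated by the product rule. The derivative of the exponential contributes
  \<open>i\<close> and that of \<open>Y(b, - z) a\<close> contributes \<open>r - i + 1\<close> to the factor \<open>r + 1\<close>.
\<close>

lemma Y_D_commutator: "Y (D a) r s b = D (Y a r s b) - Y a r s (D b)"
proof -
  define A where "A = formal_neg (\<lambda>r s. Y b r s a)"
  obtain M1 where M1: "\<And>S. finite S \<Longrightarrow> {..<M1} \<times> {..<M1} \<subseteq> S \<Longrightarrow>
    Y a r s b = (\<Sum>(i, j)\<in>S. Y (A (r - real i) (s - real j)) (real i) (real j) vac)"
    unfolding A_def using skew_symmetry_uniform by blast
  obtain M2 where M2: "\<And>S. finite S \<Longrightarrow> {..<M2} \<times> {..<M2} \<subseteq> S \<Longrightarrow>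
    Y a (r + 1) s b = (\<Sum>(i, j)\<in>S. Y (A (r + 1 - real i) (s - real j)) (real i) (real j) vac)"
    unfolding A_def using skew_symmetry_uniform by blast
  obtain M3 where M3: "\<And>S. finite S \<Longrightarrow> {..<M3} \<times> {..<M3} \<subseteq> S \<Longrightarrow>
    Y a r s (D b) = (\<Sum>(i, j)\<in>S. Y (formal_neg (\<lambda>r s. Y (D b) r s a) (r - real i) (s - real j)) (real i) (real j) vac)"
    using skew_symmetry_uniform by blast
  define M where "M = max M1 (max M2 M3)"
  let ?S = "{..<Suc M} \<times> {..<M}"
  define g where "g i j = Y (A (r + 1 - real i) (s - real j)) (real i) (real j) vac" for i j :: nat
  have "Y a r s b = (\<Sum>(i, j)\<in>{..<M} \<times> {..<M}. Y (A (r - real i) (s - real j)) (real i) (real j) vac)"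
    by (rule M1) (auto simp: M_def)
  then have "D (Y a r s b) = (\<Sum>(i, j)\<in>{..<M} \<times> {..<M}. smul (of_nat (Suc i)) (g (Suc i) j))"
    by (simp add: D_sum case_prod_unfold D_mode_vac g_def)
  also have "\<dots> = (\<Sum>(i, j)\<in>?S. smul (of_nat i) (g i j))"
    by (rule sum_shift_first) simp
  finally have 1: "D (Y a r s b) = (\<Sum>(i, j)\<in>?S. smul (of_nat i) (g i j))" .
  have "Y a r s (D b) = (\<Sum>(i, j)\<in>?S. Y (formal_neg (\<lambda>r s. Y (D b) r s a) (r - real i) (s - real j)) (real i) (real j) vac)"
    by (rule M3) (auto simp: M_def)
  also have "\<dots> = (\<Sum>(i, j)\<in>?S. - smul (of_real (r - real i + 1)) (g i j))"
    by (simp only: formal_neg_D A_def[symmetric] Y_uminus_left Y_scale_left g_def diff_add_eq)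
  finally have 2: "Y a r s (D b) = (\<Sum>(i, j)\<in>?S. - smul (of_real (r - real i + 1)) (g i j))" .
  have 3: "Y a (r + 1) s b = (\<Sum>(i, j)\<in>?S. g i j)"
    unfolding g_def by (rule M2) (auto simp: M_def)
  have "smul (of_real (r + 1)) (g i j) = smul (of_nat i) (g i j) - - smul (of_real (r - real i + 1)) (g i j)" for i j
    by (simp flip: scale_left_distrib)
  then show ?thesis
    unfolding Y_D 1 2 3 scale_sum_right sum_subtractf[symmetric]
    by (intro sum.cong) auto
qed

lemma Y_D'_commutator: "Y (D' a) r s b = D' (Y a r s b) - Y a r s (D' b)"
proof -
  define A where "A = formal_neg (\<lambda>r s. Y b r s a)"
  obtain M1 where M1: "\<And>S. finite S \<Longrightarrow> {..<M1} \<times> {..<M1} \<subseteq> S \<Longrightarrow>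
    Y a r s b = (\<Sum>(i, j)\<in>S. Y (A (r - real i) (s - real j)) (real i) (real j) vac)"
    unfolding A_def using skew_symmetry_uniform by blast
  obtain M2 where M2: "\<And>S. finite S \<Longrightarrow> {..<M2} \<times> {..<M2} \<subseteq> S \<Longrightarrow>
    Y a r (s + 1) b = (\<Sum>(i, j)\<in>S. Y (A (r - real i) (s + 1 - real j)) (real i) (real j) vac)"
    unfolding A_def using skew_symmetry_uniform by blast
  obtain M3 where M3: "\<And>S. finite S \<Longrightarrow> {..<M3} \<times> {..<M3} \<subseteq> S \<Longrightarrow>
    Y a r s (D' b) = (\<Sum>(i, j)\<in>S. Y (formal_neg (\<lambda>r s. Y (D' b) r s a) (r - real i) (s - real j)) (real i) (real j) vac)"
    using skew_symmetry_uniform by blast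
  define M where "M = max M1 (max M2 M3)"
  let ?S = "{..<M} \<times> {..<Suc M}"
  define g where "g i j = Y (A (r - real i) (s + 1 - real j)) (real i) (real j) vac" for i j :: nat
  have "Y a r s b = (\<Sum>(i, j)\<in>{..<M} \<times> {..<M}. Y (A (r - real i) (s - real j)) (real i) (real j) vac)"
    by (rule M1) (auto simp: M_def)
  then have "D' (Y a r s b) = (\<Sum>(i, j)\<in>{..<M} \<times> {..<M}. smul (of_nat (Suc j)) (g i (Suc j)))"
    by (simp add: D'_sum case_prod_unfold D'_mode_vac g_def)
  also have "\<dots> = (\<Sum>(i, j)\<in>?S. smul (of_nat j) (g i j))"
    by (rule sum_shift_second) simp
  finally have 1: "D' (Y a r s b) = (\<Sum>(i, j)\<in>?S. smul (of_nat j) (g i j))" .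
  have "Y a r s (D' b) = (\<Sum>(i, j)\<in>?S. Y (formal_neg (\<lambda>r s. Y (D' b) r s a) (r - real i) (s - real j)) (real i) (real j) vac)"
    by (rule M3) (auto simp: M_def)
  also have "\<dots> = (\<Sum>(i, j)\<in>?S. - smul (of_real (s - real j + 1)) (g i j))"
    by (simp only: formal_neg_D' A_def[symmetric] Y_uminus_left Y_scale_left g_def diff_add_eq)
  finally have 2: "Y a r s (D' b) = (\<Sum>(i, j)\<in>?S. - smul (of_real (s - real j + 1)) (g i j))" .
  have 3: "Y a r (s + 1) b = (\<Sum>(i, j)\<in>?S. g i j)"
    unfolding g_def by (rule M2) (auto simp: M_def)
  have "smul (of_real (s + 1)) (g i j) = smul (of_nat j) (g i j) - - smul (of_real (s - real j + 1)) (g i j)" for i j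
    by (simp flip: scale_left_distrib)
  then show ?thesis
    unfolding Y_D' 1 2 3 scale_sum_right sum_subtractf[symmetric]
    by (intro sum.cong) auto
qed

lemma D_vac: "D vac = 0" and D'_vac: "D' vac = 0"
  by (simp_all add: translation_def translation_bar_def FV4)

lemma D_D'_commute: "D (D' v) = D' (D v)"
proof -
  have "D (D' v) = Y v 1 1 vac" by (simp add: translation_def[of _ _ "D' v"] Y_D')
  moreover have "D' (D v) = Y v 1 1 vac" by (simp add: translation_bar_def[of _ _ "D v"] Y_D)
  ultimately show ?thesis by simp
qed

end

section \<open>The translation operators of a full vertex algebra\<close>

theorem proposition2p1:
  fixes smul :: "complex \<Rightarrow> 'v::ab_group_add \<Rightarrow> 'v"
    and F :: "real \<Rightarrow> real \<Rightarrow> 'v set"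
    and Y :: "'v \<Rightarrow> real \<Rightarrow> real \<Rightarrow> 'v \<Rightarrow> 'v"
    and vac a b :: 'v
  assumes "full_vertex_algebra smul F Y vac"
  shows
    "let D = translation Y vac; D' = translation_bar Y vac; smul_End = (\<lambda>c T v. smul c (T v)) in
       (Y (D a) = formal_dz smul_End (Y a) \<and> Y (D' a) = formal_dzbar smul_End (Y a)) \<and>
       (D vac = 0 \<and> D' vac = 0) \<and>
       commutator D D' = 0 \<and>
       (\<lambda>r s. Y a r s b) =
         power_series_apply (exp_zSzT smul D D') (formal_neg (\<lambda>r s. Y b r s a)) \<and>
       (Y (D' a) = (\<lambda>r s. commutator D' (Y a r s)) \<and> Y (D a) = (\<lambda>r s. commutator D (Y a r s)))"
proof -
  interpret full_vertex_algebra smul F Y vac by fact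
  show ?thesis
    unfolding Let_def formal_dz_def formal_dzbar_def commutator_def fun_eq_iff zero_fun_def
    by (intro conjI allI Y_D Y_D' D_vac D'_vac skew_symmetry_exp Y_D_commutator Y_D'_commutator)
       (simp add: D_D'_commute)
qed

end
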